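(* (i) For every integer $k\ge1$, with $n=3k+1$, and every $\delta>0$, there exists a cake-cutting instance with $n$ players exhibiting an $\alpha$-dumping paradox with respect to the egalitarian welfare (for connected divisions) with $\alpha\ge (1-\delta)\frac{n}{3}$. More precisely, for all sufficiently small $\epsilon>0$ there is such an instance in which every envy-free complete division has egalitarian welfare at most $\frac1n$, while there is an envy-free partial division (leaving $k$ intervals unallocated) with egalitarian welfare $\frac{1-\epsilon}{3}$. (ii) For every $n$, every instance with $n$ players exhibiting an egalitarian $\alpha$-dumping paradox (for connected divisions) has $\alpha\le \frac n2$.
   Context: A cake is the interval $[0,1]$. There are $n$ players $1,\dots,n$; each player $i$ has a valuation $v_i$, a nonatomic countably additive probability measure on the Borel subsets of $[0,1]$. A (connected) division $x$ is a sequence $(X_1,\dots,X_n)$ of pairwise disjoint open intervals of $[0,1]$ (possibly empty), $X_i$ being the piece of player $i$; it is complete if the union of the closures of the $X_i$ equals $[0,1]$, and partial otherwise. Write $u_i(x,j)=v_i(X_j)$. $x$ is envy-free if $u_i(x,i)\ge u_i(x,j)$ for all $i,j$. Egalitarian welfare: $eg(x)=\min_i u_i(x,i)$. For a welfare function $w$ and $\alpha>1$, an instance exhibits an $\alpha$-dumping paradox with respect to $w$ if there exists an envy-free partial division $y$ such that $w(y)\ge \alpha\,w(x)$ for every envy-free complete division $x$. *)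

theory Defs
  imports "HOL-Probability.Probability"
begin

definition nonatomic :: "real measure \<Rightarrow> bool" where
  "nonatomic M \<longleftrightarrow> (\<forall>A\<in>sets M. emeasure M A > 0 \<longrightarrow>
      (\<exists>B\<in>sets M. B \<subseteq> A \<and> 0 < emeasure M B \<and> emeasure M B < emeasure M A))"

definition valuation :: "real measure \<Rightarrow> bool" where
  "valuation M \<longleftrightarrow> prob_space M \<and> space M = {0..1}
     \<and> sets M = sets (restrict_space borel {0..1}) \<and> nonatomic M"

definition cake_instance :: "nat \<Rightarrow> (nat \<Rightarrow> real measure) \<Rightarrow> bool" where
  "cake_instance n v \<longleftrightarrow> (\<forall>i<n. valuation (v i))"

definition division :: "nat \<Rightarrow> (nat \<Rightarrow> real set) \<Rightarrow> bool" where
  "division n X \<longleftrightarrow>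
     (\<forall>i<n. \<exists>a b. 0 \<le> a \<and> a \<le> b \<and> b \<le> 1 \<and> X i = {a<..<b})
     \<and> (\<forall>i<n. \<forall>j<n. i \<noteq> j \<longrightarrow> X i \<inter> X j = {})"

definition complete_div :: "nat \<Rightarrow> (nat \<Rightarrow> real set) \<Rightarrow> bool" where
  "complete_div n X \<longleftrightarrow> (\<Union>i<n. closure (X i)) = {0..1}"

definition util :: "(nat \<Rightarrow> real measure) \<Rightarrow> (nat \<Rightarrow> real set) \<Rightarrow> nat \<Rightarrow> nat \<Rightarrow> real" where
  "util v X i j = measure (v i) (X j)"

definition envy_free :: "nat \<Rightarrow> (nat \<Rightarrow> real measure) \<Rightarrow> (nat \<Rightarrow> real set) \<Rightarrow> bool" where
  "envy_free n v X \<longleftrightarrow> (\<forall>i<n. \<forall>j<n. util v X i i \<ge> util v X i j)"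

definition eg :: "nat \<Rightarrow> (nat \<Rightarrow> real measure) \<Rightarrow> (nat \<Rightarrow> real set) \<Rightarrow> real" where
  "eg n v X = Min {util v X i i | i. i < n}"

definition eg_dumping_paradox :: "nat \<Rightarrow> (nat \<Rightarrow> real measure) \<Rightarrow> real \<Rightarrow> bool" where
  "eg_dumping_paradox n v \<alpha> \<longleftrightarrow> \<alpha> > 1 \<and>
     (\<exists>Y. division n Y \<and> \<not> complete_div n Y \<and> envy_free n v Y \<and>
        (\<forall>X. division n X \<and> complete_div n X \<and> envy_free n v X \<longrightarrow> eg n v Y \<ge> \<alpha> * eg n v X))"

end

theory Submission
  imports Defs
begin

text \<open>For the upper bound, every instance has an envy-free complete division, in which everybody gets at
  least \<open>1/n\<close>. If a partial envy-free division gave everybody at least one half, any completion of it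
  would still be envy-free and at least as good; so its egalitarian welfare is below one half.
  Existence is Su's argument: on a fine triangulation each vertex, a division, is owned by one
  player and labelled by that player's favourite piece. Here it is run on Kuhn's triangulation of
  the cube, with the cube parametrizing divisions by stick breaking.

  For the lower bound, the cake is cut into \<open>11k + 1\<close> cells with constant densities. One player
  values \<open>3k + 1\<close> marker cells equally, and between consecutive markers lies one item: two items
  for each of \<open>k\<close> blocks, then one further item per block at the far right. If the marker player
  gets more than \<open>1/n\<close>, their piece swallows an item. This forces the three players of the
  block into a configuration in which the discardable gap cannot be given to anybody without
  creating envy. Discarding it, these three fit into their block, and the marker player can take
  the whole right end of the cake.\<close>

subsection \<open>Envy-free points by Kuhn's combinatorial lemma\<close>

text \<open>Player \<open>3 * i\<close> of a block transmits the conflict. It splits its value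
  between cells \<open>9 * i + 1\<close> and \<open>9 * k + 2 * i + 1\<close>, so whoever takes one
  of them pins it to the other, and both are lost to players \<open>3 * i + 1\<close> and
  \<open>3 * i + 2\<close>. The former values both cells at \<open>q\<close>, the latter only the
  second, so envy makes each demand \<open>q\<close> elsewhere. In the second item their cells
  interlace: \<open>3 * i + 1\<close> needs both halves \<open>q / 2\<close>, at
  \<open>9 * i + 5\<close> and \<open>9 * i + 7\<close>, and thereby swallows
  \<open>9 * i + 6\<close>, leaving \<open>9 * i + 8\<close> to \<open>3 * i + 2\<close>. Both then
  stand at exactly \<open>q\<close>, so any surplus \<open>e\<close>, however small, creates envy.
  The constants: three portions of \<open>q\<close> and one \<open>e\<close> must add up to 1, hence
  \<open>q = (1 - e) / 3\<close>. With three players per block, the \<open>k + 1\<close> markers at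
  the right end are more than a third of all \<open>3 * k + 1\<close>, so the marker player does not
  lower the welfare of the partial division below \<open>q\<close>.\<close>

lemma bij_betw_add_mod: "bij_betw (\<lambda>i. (b + i) mod Suc m) {..m} {..m}" for b m :: nat
proof -
  have "inj_on (\<lambda>i. (b + i) mod Suc m) {..m}"
  proof (rule inj_onI)
    fix i j assume ij: "i \<in> {..m}" "j \<in> {..m}" "(b + i) mod Suc m = (b + j) mod Suc m"
    then have "int (Suc m) dvd int (b + i) - int (b + j)"
      by (metis mod_eq_dvd_iff zmod_int)
    then have "int (Suc m) dvd int i - int j" by simp
    moreover have "\<bar>int i - int j\<bar> < int (Suc m)" using ij by auto
    ultimately show "i = j" using zdvd_imp_le[of "int (Suc m)" "\<bar>int i - int j\<bar>"] by force
  qed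
  moreover have "(\<lambda>i. (b + i) mod Suc m) ` {..m} \<subseteq> {..m}" by (auto simp: less_Suc_eq_le[symmetric])
  ultimately show ?thesis by (simp add: bij_betw_def endo_inj_surj)
qed

text \<open>The owner of a grid point is its coordinate sum modulo the number of players. Consecutive
  vertices of a Kuhn simplex differ by one in a single coordinate, so each simplex has exactly one
  vertex per owner, and labelling every vertex by the choice of its owner turns a fully labelled
  simplex into an assignment of distinct labels to the players.\<close>

lemma kuhn_rainbow:
  fixes R :: "nat \<Rightarrow> (nat \<Rightarrow> nat) \<Rightarrow> nat"
  assumes p: "0 < p"
    and R_le: "\<And>i x. \<forall>j. x j \<le> p \<Longrightarrow> R i x \<le> m"
    and R_0: "\<And>i x j. \<forall>j. x j \<le> p \<Longrightarrow> j < m \<Longrightarrow> x j = 0 \<Longrightarrow> R i x \<noteq> j"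
    and R_p: "\<And>i x j. \<forall>j. x j \<le> p \<Longrightarrow> j < m \<Longrightarrow> x j = p \<Longrightarrow> R i x \<le> j"
  obtains b x where "\<forall>j<m. b j < p" and "\<forall>i\<le>m. \<forall>j. x i j \<le> p"
    and "\<forall>i\<le>m. \<forall>j<m. b j \<le> x i j \<and> x i j \<le> Suc (b j)"
    and "bij_betw (\<lambda>i. R i (x i)) {..m} {..m}"
proof -
  define own where "own x = (\<Sum>j<m. x j) mod Suc m" for x :: "nat \<Rightarrow> nat"
  \<comment> \<open>\<open>reduced\<close> picks the first index labelled 1, or \<open>m\<close> if
    there is none, so all indices before the chosen one get 0. The clause \<open>x j = 0\<close> is
    what Kuhn's lemma demands on the lower faces; it cannot hide the choice, because
    \<open>R_0\<close> forbids choosing \<open>j\<close> there.\<close>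
  define lab where "lab x j = (if x j = 0 \<or> j < R (own x) x then 0 else 1::nat)" for x j
  have red: "reduced m (lab x) = R (own x) x" if x: "\<forall>j. x j \<le> p" for x
    using R_le[OF x, of "own x"] R_0[OF x, of "R (own x) x" "own x"]
    by (intro reduced_labelling_unique) (auto simp: lab_def le_less)
  let ?A = "{s. ksimplex p m s \<and> (reduced m \<circ> lab) ` s = {..m}}"
  have "odd (card ?A)"
  proof (rule kuhn_combinatorial[OF p])
    show "\<forall>x j. (\<forall>j. x j \<le> p) \<and> j < m \<and> x j = p \<longrightarrow> lab x j = 1"
      using p R_p by (auto simp: lab_def leD)
  qed (auto simp: lab_def)
  then have "?A \<noteq> {}" by (rule odd_card_imp_not_empty)
  then obtain s base u where ks: "kuhn_simplex p m base u s"
    and lab: "(reduced m \<circ> lab) ` s = {..m}"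
    by (auto elim: ksimplex.cases)
  interpret kuhn_simplex p m base u s by fact
  have sum_enum: "(\<Sum>j<m. enum i j) = (\<Sum>j<m. base j) + i" if "i \<le> m" for i
    using that
  proof (induction i)
    case (Suc i)
    then have "u i < m" using upd_space by simp
    then have "(\<Sum>j<m. enum (Suc i) j) = (\<Sum>j<m. enum i j) + 1"
      using Suc.prems by (simp add: enum_Suc sum.remove[of _ "u i"])
    then show ?case using Suc by simp
  qed (simp add: enum_0)
  define B where "B = (\<Sum>j<m. base j)"
  have own_enum: "own (enum i) = (B + i) mod Suc m" if "i \<le> m" for i
    using sum_enum[OF that] by (simp add: own_def B_def)
  have bij: "bij_betw (own \<circ> enum) {..m} {..m}"
    using bij_betw_cong[of "{..m}" "own \<circ> enum" "\<lambda>i. (B + i) mod Suc m"] own_enum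
      bij_betw_add_mod[of B m] by simp
  \<comment> \<open>The vertex of the simplex that player \<open>i\<close> owns.\<close>
  define x where "x i = enum (the_inv_into {..m} (own \<circ> enum) i)" for i
  have inv: "the_inv_into {..m} (own \<circ> enum) i \<le> m" "own (x i) = i" if "i \<le> m" for i
    using that bij_betw_imp_inj_on[OF bij] the_inv_into_into[of "own \<circ> enum" "{..m}" i "{..m}"]
      f_the_inv_into_f_bij_betw[OF bij, of i] bij_betw_imp_surj_on[OF bij]
    by (auto simp: x_def)
  have x_in: "x i \<in> s" if "i \<le> m" for i
    using inv(1)[OF that] by (simp add: x_def enum_in)
  have lx: "reduced m (lab (x i)) = R i (x i)" if "i \<le> m" for i
    using red[of "x i"] s_le_p[OF x_in[OF that]] inv(2)[OF that] by simp
  have xs: "x ` {..m} = s"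
  proof -
    have "the_inv_into {..m} (own \<circ> enum) ` {..m} = {..m}"
      using bij_betw_imp_surj_on[OF bij_betw_the_inv_into[OF bij]] .
    then show ?thesis unfolding x_def s_eq by (metis image_image)
  qed
  have "(\<lambda>i. R i (x i)) ` {..m} = (\<lambda>i. (reduced m \<circ> lab) (x i)) ` {..m}"
    using lx by (intro image_cong) auto
  also have "\<dots> = {..m}" using lab xs by (metis image_image)
  finally have "bij_betw (\<lambda>i. R i (x i)) {..m} {..m}"
    by (simp add: bij_betw_def eq_card_imp_inj_on)
  then show ?thesis
    using that[of base x] base x_in base_le le_Suc_base s_le_p by (fastforce simp: Pi_iff)
qed

lemma compact_unit_cube: "compact {y :: nat \<Rightarrow> real. \<forall>j. y j \<in> {0..1}}"
proof -
  have "compactin (product_topology (\<lambda>_. euclidean) UNIV) (PiE UNIV (\<lambda>_::nat. {0..1::real}))"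
    by (simp add: compactin_PiE)
  then show ?thesis
    by (simp add: euclidean_product_topology PiE_UNIV_domain Pi_def)
qed

text \<open>A limit of grid solutions: one of the finitely many assignments recurs on infinitely
  many grids, and as the mesh shrinks the vertices of all players tend to a common point.
  \<open>pos\<close> makes every favourite strictly positive, which turns \<open>zero\<close> and
  \<open>one\<close> into the boundary conditions of \<open>kuhn_rainbow\<close>.\<close>

lemma envy_free_point_exists:
  fixes u :: "nat \<Rightarrow> nat \<Rightarrow> (nat \<Rightarrow> real) \<Rightarrow> real"
  assumes cont: "\<And>i k. i \<le> m \<Longrightarrow> k \<le> m \<Longrightarrow> continuous_on UNIV (u i k)"
    and pos: "\<And>i y. i \<le> m \<Longrightarrow> \<forall>j. y j \<in> {0..1} \<Longrightarrow> \<exists>k\<le>m. 0 < u i k y"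
    and zero: "\<And>i y j. i \<le> m \<Longrightarrow> \<forall>j. y j \<in> {0..1} \<Longrightarrow> j < m \<Longrightarrow> y j = 0 \<Longrightarrow> u i j y \<le> 0"
    and one: "\<And>i y j k. i \<le> m \<Longrightarrow> \<forall>j. y j \<in> {0..1} \<Longrightarrow> y j = 1 \<Longrightarrow> j < k \<Longrightarrow> k \<le> m \<Longrightarrow> u i k y \<le> 0"
  obtains y \<pi> where "\<forall>j. y j \<in> {0..1}" and "bij_betw \<pi> {..m} {..m}"
    and "\<forall>i\<le>m. \<forall>k\<le>m. u i k y \<le> u i (\<pi> i) y"
proof -
  \<comment> \<open>Coordinates from \<open>m\<close> on are set to 0, as
    \<open>kuhn_rainbow\<close> says nothing about those of \<open>b\<close>. The bounds then hold
    in every coordinate, as needed for compactness of the infinite product and for componentwise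
    convergence.\<close>
  define sc where "sc p x j = (if j < m then real (x j) / real p else 0)" for p and x :: "nat \<Rightarrow> nat" and j
  have "\<exists>b x \<pi>. (\<forall>j. sc (Suc p) b j \<in> {0..1}) \<and> (\<forall>i\<le>m. \<forall>j. \<bar>sc (Suc p) (x i) j - sc (Suc p) b j\<bar> \<le> 1 / real (Suc p))
      \<and> \<pi> \<in> {..m} \<rightarrow>\<^sub>E {..m} \<and> bij_betw \<pi> {..m} {..m}
      \<and> (\<forall>i\<le>m. \<forall>k\<le>m. u i k (sc (Suc p) (x i)) \<le> u i (\<pi> i) (sc (Suc p) (x i)))" for p
  proof -
    let ?P = "Suc p"
    have "\<exists>r\<le>m. \<forall>k\<le>m. f k \<le> f r" for f :: "nat \<Rightarrow> real"
    proof -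
      have "Max (f ` {..m}) \<in> f ` {..m}" by (rule Max_in) auto
      moreover have "f k \<le> Max (f ` {..m})" if "k \<le> m" for k using that by (intro Max_ge) auto
      ultimately show ?thesis by (metis atMost_iff imageE)
    qed
    then obtain best where best: "best f \<le> m" "\<forall>k\<le>m. f k \<le> f (best f)" for f :: "nat \<Rightarrow> real"
      by metis
    \<comment> \<open>\<open>kuhn_rainbow\<close> asks for a choice rule for every number
      \<open>i\<close>; numbers beyond \<open>m\<close> imitate player 0.\<close>
    define R where "R i x = best (\<lambda>k. u (if i \<le> m then i else 0) k (sc ?P x))" for i x
    have R: "\<exists>i'\<le>m. R i x \<le> m \<and> (\<forall>k\<le>m. u i' k (sc ?P x) \<le> u i' (R i x) (sc ?P x)) \<and> (i \<le> m \<longrightarrow> i' = i)" for i x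
      using best[of "\<lambda>k. u (if i \<le> m then i else 0) k (sc ?P x)"] unfolding R_def
      by (intro exI[of _ "if i \<le> m then i else 0"]) auto
    have cube: "\<forall>j. sc ?P x j \<in> {0..1}" if "\<forall>j. x j \<le> ?P" for x
      using that by (auto simp: sc_def divide_simps simp flip: of_nat_Suc)
    obtain b x where bx: "\<forall>j<m. b j < ?P" "\<forall>i\<le>m. \<forall>j. x i j \<le> ?P"
      "\<forall>i\<le>m. \<forall>j<m. b j \<le> x i j \<and> x i j \<le> Suc (b j)" "bij_betw (\<lambda>i. R i (x i)) {..m} {..m}"
    proof (rule kuhn_rainbow[of ?P R m])
      show "R i x \<le> m" for i x using R by blast
      show "R i x \<noteq> j" if "\<forall>j. x j \<le> ?P" "j < m" "x j = 0" for i x j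
      proof -
        obtain i' where i': "i' \<le> m" "\<forall>k\<le>m. u i' k (sc ?P x) \<le> u i' (R i x) (sc ?P x)" using R by blast
        have "sc ?P x j = 0" using that by (simp add: sc_def)
        then have "u i' j (sc ?P x) \<le> 0" using zero i'(1) cube that by blast
        then show ?thesis using pos[OF i'(1) cube[OF that(1)]] i'(2) by force
      qed
      show "R i x \<le> j" if "\<forall>j. x j \<le> ?P" "j < m" "x j = ?P" for i x j
      proof (rule ccontr)
        assume j: "\<not> R i x \<le> j"
        obtain i' where i': "i' \<le> m" "R i x \<le> m" "\<forall>k\<le>m. u i' k (sc ?P x) \<le> u i' (R i x) (sc ?P x)" using R by blast
        have "sc ?P x j = 1" using that by (simp add: sc_def del: of_nat_Suc)
        then have "u i' (R i x) (sc ?P x) \<le> 0" using one[of i' _ j "R i x"] i' cube that j by auto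
        then show False using pos[OF i'(1) cube[OF that(1)]] i'(3) by force
      qed
    qed auto
    \<comment> \<open>Restricting puts the assignment into a finite function space, so that the
      pigeonhole principle applies below.\<close>
    define \<pi> where "\<pi> = restrict (\<lambda>i. R i (x i)) {..m}"
    have "\<bar>sc ?P (x i) j - sc ?P b j\<bar> \<le> 1 / real ?P" if "i \<le> m" for i j
    proof (cases "j < m")
      case True
      then have "\<bar>real (x i j) - real (b j)\<bar> \<le> 1" using bx(3) that by fastforce
      then show ?thesis using True by (simp add: sc_def diff_divide_distrib[symmetric] abs_divide divide_right_mono del: of_nat_Suc)
    qed (simp add: sc_def)
    moreover have "sc ?P b j \<in> {0..1}" for j
      using bx(1) by (auto simp: sc_def divide_simps simp flip: of_nat_Suc)
    moreover have "\<pi> \<in> {..m} \<rightarrow>\<^sub>E {..m}" using R by (auto simp: \<pi>_def)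
    moreover have "bij_betw \<pi> {..m} {..m}" using bx(4) by (subst bij_betw_cong[of _ _ "\<lambda>i. R i (x i)"]) (auto simp: \<pi>_def)
    moreover have "u i k (sc ?P (x i)) \<le> u i (\<pi> i) (sc ?P (x i))" if "i \<le> m" "k \<le> m" for i k
      using R[of i "x i"] that by (auto simp: \<pi>_def)
    ultimately show ?thesis by blast
  qed
  then obtain b x \<pi> where b: "\<And>p j. sc (Suc p) (b p) j \<in> {0..1}"
    and x: "\<And>p i j. i \<le> m \<Longrightarrow> \<bar>sc (Suc p) (x p i) j - sc (Suc p) (b p) j\<bar> \<le> 1 / real (Suc p)"
    and \<pi>: "\<And>p. \<pi> p \<in> {..m} \<rightarrow>\<^sub>E {..m}" "\<And>p. bij_betw (\<pi> p) {..m} {..m}"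
    and u: "\<And>p i k. i \<le> m \<Longrightarrow> k \<le> m \<Longrightarrow> u i k (sc (Suc p) (x p i)) \<le> u i (\<pi> p i) (sc (Suc p) (x p i))"
    by metis
  have "finite ({..m} \<rightarrow>\<^sub>E {..m})" by (simp add: finite_PiE)
  then have "finite (range \<pi>)" using \<pi>(1) by (auto intro: finite_subset)
  then obtain p0 where inf: "infinite {p. \<pi> p = \<pi> p0}"
    using pigeonhole_infinite[of UNIV \<pi>] by auto
  define r where "r = enumerate {p. \<pi> p = \<pi> p0}"
  have r: "strict_mono r" "\<And>l. \<pi> (r l) = \<pi> p0"
    unfolding r_def using strict_mono_enumerate[OF inf] enumerate_in_set[OF inf] by auto
  have "seq_compact {y :: nat \<Rightarrow> real. \<forall>j. y j \<in> {0..1}}"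
    using compact_unit_cube by (simp add: compact_eq_seq_compact_metric)
  moreover have "\<forall>l. sc (Suc (r l)) (b (r l)) \<in> {y :: nat \<Rightarrow> real. \<forall>j. y j \<in> {0..1}}"
    using b by simp
  ultimately obtain y t where "y \<in> {y :: nat \<Rightarrow> real. \<forall>j. y j \<in> {0..1}}" and t: "strict_mono t"
    and lim: "((\<lambda>l. sc (Suc (r l)) (b (r l))) \<circ> t) \<longlonglongrightarrow> y"
    by (rule seq_compactE)
  then have y: "\<forall>j. y j \<in> {0..1}" by simp
  define P where "P = r \<circ> t"
  have P: "strict_mono P" using r(1) t by (simp add: P_def strict_mono_o)
  have inv0: "(\<lambda>l. 1 / real (Suc (P l))) \<longlonglongrightarrow> 0"
    using LIMSEQ_subseq_LIMSEQ[OF LIMSEQ_inverse_real_of_nat P] by (simp add: o_def inverse_eq_divide)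
  have lim_x: "(\<lambda>l. sc (Suc (P l)) (x (P l) i)) \<longlonglongrightarrow> y" if i: "i \<le> m" for i
  proof -
    have *: "(\<lambda>l. sc (Suc (P l)) (x (P l) i) j) \<longlonglongrightarrow> y j" for j
    proof -
      have "continuous_on UNIV (\<lambda>y::nat \<Rightarrow> real. y j)" by (rule continuous_on_product_coordinates)
      then have "(\<lambda>l. sc (Suc (P l)) (b (P l)) j) \<longlonglongrightarrow> y j"
        using lim continuous_on_tendsto_compose[of UNIV "\<lambda>y::nat \<Rightarrow> real. y j"]
        by (simp add: P_def o_def)
      moreover have "(\<lambda>l. sc (Suc (P l)) (x (P l) i) j - sc (Suc (P l)) (b (P l)) j) \<longlonglongrightarrow> 0"
        by (rule Lim_null_comparison[OF _ inv0]) (use x[OF i] in auto)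
      ultimately show ?thesis using tendsto_add by fastforce
    qed
    then show ?thesis
      using limitin_componentwise[of "\<lambda>_. euclidean" UNIV "\<lambda>l. sc (Suc (P l)) (x (P l) i)" y sequentially]
      by (simp add: euclidean_product_topology)
  qed
  show ?thesis
  proof (rule that[OF y \<pi>(2)[of p0]], intro allI impI)
    fix i k assume ik: "i \<le> m" "k \<le> m"
    then have k': "\<pi> p0 i \<le> m" using \<pi>(1)[of p0] by auto
    have l: "(\<lambda>l. u i k (sc (Suc (P l)) (x (P l) i))) \<longlonglongrightarrow> u i k y" if "k \<le> m" for k
      using continuous_on_tendsto_compose[OF cont[OF ik(1) that] lim_x[OF ik(1)]] by simp
    have "u i k (sc (Suc (P l)) (x (P l) i)) \<le> u i (\<pi> p0 i) (sc (Suc (P l)) (x (P l) i))" for l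
      using u[OF ik, of "P l"] r(2)[of "t l"] by (simp add: P_def)
    then show "u i k y \<le> u i (\<pi> p0 i) y"
      by (intro LIMSEQ_le[OF l[OF ik(2)] l[OF k']]) blast
  qed
qed

subsection \<open>Envy-free complete divisions and the upper bound\<close>

lemma valuation_sets: "valuation M \<Longrightarrow> A \<in> sets borel \<Longrightarrow> A \<subseteq> {0..1} \<Longrightarrow> A \<in> sets M"
  by (auto simp: valuation_def sets_restrict_space)

text \<open>A subset of \<open>{x}\<close> is empty or everything, so none has the intermediate
  measure that nonatomicity would provide.\<close>

lemma valuation_measure_singleton:
  assumes M: "valuation M"
  shows "measure M {x} = 0"
proof (cases "x \<in> {0..1}")
  case True
  have "\<not> emeasure M {x} > 0"
  proof
    assume pos: "emeasure M {x} > 0"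
    have "{x} \<in> sets M" using True by (intro valuation_sets[OF M]) auto
    then obtain B where "B \<subseteq> {x}" "0 < emeasure M B" "emeasure M B < emeasure M {x}"
      using M pos unfolding valuation_def nonatomic_def by blast
    then show False by (metis emeasure_empty less_irrefl subset_singletonD)
  qed
  then show ?thesis by (simp add: measure_def)
next
  case False
  then have "{x} \<notin> sets M" using M sets.sets_into_space[of "{x}" M] by (auto simp: valuation_def)
  then show ?thesis by (simp add: measure_notin_sets)
qed

lemma valuation_measure_finite:
  assumes M: "valuation M" and "finite A"
  shows "measure M A = 0"
proof (cases "A \<in> sets M")
  case True
  interpret prob_space M using M by (simp add: valuation_def)
  have "A \<subseteq> {0..1}" using True M sets.sets_into_space by (auto simp: valuation_def)
  then have "measure M A = (\<Sum>x\<in>A. measure M {x})"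
    using assms by (intro finite_measure_eq_sum_singleton) (auto intro!: valuation_sets[OF M])
  then show ?thesis using valuation_measure_singleton[OF M] by simp
qed (simp add: measure_notin_sets)

text \<open>Pushing \<open>M\<close> forward to the whole line makes the theory of
  \<open>cdf\<close> available. Null points give continuity and let open intervals replace half-open
  ones.\<close>

lemma valuation_cdf:
  assumes M: "valuation M"
  obtains F :: "real \<Rightarrow> real" where "continuous_on UNIV F" and "F 0 = 0" and "F 1 = 1"
    and "\<And>a b. 0 \<le> a \<Longrightarrow> a \<le> b \<Longrightarrow> b \<le> 1 \<Longrightarrow> measure M {a<..<b} = F b - F a"
proof -
  interpret M: prob_space M using M by (simp add: valuation_def)
  have sp: "space M = {0..1}" using M by (simp add: valuation_def)
  have meas: "(\<lambda>x. x) \<in> M \<rightarrow>\<^sub>M borel"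
  proof -
    have "borel_measurable M = borel_measurable (restrict_space borel {0..1::real})"
      using M by (intro measurable_cong_sets) (auto simp: valuation_def)
    then show ?thesis using measurable_restrict_space1[of "\<lambda>x. x" borel borel "{0..1::real}"]
      by (metis measurable_ident_sets id_def measurable_ident)
  qed
  define D where "D = distr M borel (\<lambda>x. x)"
  interpret D: real_distribution D unfolding D_def by (rule M.real_distribution_distr) (rule meas)
  have D: "measure D A = measure M (A \<inter> {0..1})" if "A \<in> sets borel" for A
    unfolding D_def using that meas by (subst measure_distr) (auto simp: sp)
  have D0: "measure D {x} = 0" for x
    using valuation_measure_finite[OF M, of "{x} \<inter> {0..1}"] by (simp add: D)
  show ?thesis
  proof (rule that[of "cdf D"])
    show "continuous_on UNIV (cdf D)"
      by (auto simp: continuous_on_eq_continuous_at D.isCont_cdf D0)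
    show "cdf D 0 = 0"
      using valuation_measure_finite[OF M, of "{..0} \<inter> {0..1}"] by (simp add: cdf_def2 D)
    have "{..1} \<inter> {0..1} = space M" by (auto simp: sp)
    then have "measure M ({..1} \<inter> {0..1}) = 1" by (simp only: M.prob_space)
    then show "cdf D 1 = 1" by (simp add: cdf_def2 D)
    show "measure M {a<..<b} = cdf D b - cdf D a" if "0 \<le> a" "a \<le> b" "b \<le> 1" for a b
    proof (cases "a < b")
      case True
      have "measure D {a<..b} = measure D ({a<..<b} \<union> {b})"
        using True by (intro arg_cong[where f = "measure D"]) auto
      also have "\<dots> = measure D {a<..<b}" by (subst D.finite_measure_Union) (auto simp: D0)
      also have "\<dots> = measure M {a<..<b}"
        using that by (subst D) (auto intro!: arg_cong[where f = "measure M"])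
      finally show ?thesis using D.cdf_diff_eq[OF True] by simp
    qed (use that in auto)
  qed
qed

section \<open>Divisions, completeness and proportionality\<close>

lemma divisionE:
  assumes "division n X"
  obtains a b where "\<And>i. i < n \<Longrightarrow> 0 \<le> a i \<and> a i \<le> b i \<and> b i \<le> 1 \<and> X i = {a i<..<b i}"
proof -
  have "\<forall>i. \<exists>ab. i < n \<longrightarrow> 0 \<le> fst ab \<and> fst ab \<le> snd ab \<and> snd ab \<le> 1 \<and> X i = {fst ab<..<snd ab}"
  proof
    fix i
    show "\<exists>ab. i < n \<longrightarrow> 0 \<le> fst ab \<and> fst ab \<le> snd ab \<and> snd ab \<le> 1 \<and> X i = {fst ab<..<snd ab}"
    proof (cases "i < n")
      case True
      then obtain a b where "0 \<le> a \<and> a \<le> b \<and> b \<le> 1 \<and> X i = {a<..<b}"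
        using assms unfolding division_def by blast
      then show ?thesis by (intro exI[of _ "(a, b)"]) simp
    qed simp
  qed
  then obtain ab where "\<forall>i. i < n \<longrightarrow> 0 \<le> fst (ab i) \<and> fst (ab i) \<le> snd (ab i) \<and> snd (ab i) \<le> 1
      \<and> X i = {fst (ab i)<..<snd (ab i)}"
    by (rule choice[THEN exE])
  then show ?thesis using that[of "fst \<circ> ab" "snd \<circ> ab"] by simp
qed

lemma division_subset:
  assumes "division n X" "i < n"
  shows "X i \<subseteq> {0..1}"
proof -
  obtain a b where "0 \<le> a" "b \<le> 1" "X i = {a<..<b}" using assms unfolding division_def by blast
  then show ?thesis by auto
qed

lemma division_open:
  assumes "division n X" "i < n"
  shows "open (X i)"
proof -
  obtain a b where "X i = {a<..<b}" using assms unfolding division_def by blast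
  then show ?thesis by simp
qed

lemma division_sets: "valuation M \<Longrightarrow> division n X \<Longrightarrow> i < n \<Longrightarrow> X i \<in> sets M"
  by (rule valuation_sets[OF _ borel_open[OF division_open] division_subset])

text \<open>Completeness speaks of closures, but these add only finitely many end points, which are
  null.\<close>

lemma complete_div_measure_sum:
  assumes M: "valuation M" and X: "division n X" "complete_div n X"
  shows "(\<Sum>j<n. measure M (X j)) = 1"
proof -
  interpret prob_space M using M by (simp add: valuation_def)
  obtain a b where ab: "\<And>i. i < n \<Longrightarrow> 0 \<le> a i \<and> a i \<le> b i \<and> b i \<le> 1 \<and> X i = {a i<..<b i}"
    by (rule divisionE[OF X(1)], rule that)
  have cl: "closure {c<..<d} \<subseteq> {c<..<d} \<union> {c, d}" for c d :: real
    by (cases "c < d") auto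
  have "closure (X i) \<subseteq> X i \<union> {a i, b i}" if "i < n" for i
    using ab[OF that] cl[of "a i" "b i"] by presburger
  then have "(\<Union>i<n. closure (X i)) \<subseteq> (\<Union>i<n. X i) \<union> (a ` {..<n} \<union> b ` {..<n})"
    by blast
  then have "{0..1} - (\<Union>i<n. X i) \<subseteq> a ` {..<n} \<union> b ` {..<n}"
    using X(2) by (simp only: complete_div_def Diff_subset_conv)
  then have fin: "finite ({0..1} - (\<Union>i<n. X i))"
    by (rule finite_subset) simp
  have sets: "X j \<in> sets M" if "j < n" for j using division_sets[OF M X(1) that] .
  have U: "(\<Union>j<n. X j) \<in> sets M" using sets by (intro sets.finite_UN) auto
  have "disjoint_family_on X {..<n}"
    using X(1) unfolding disjoint_family_on_def division_def by blast
  then have "(\<Sum>j<n. measure M (X j)) = measure M (\<Union>j<n. X j)"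
    using sets by (subst finite_measure_finite_Union) auto
  moreover have "measure M ({0..1} - (\<Union>j<n. X j)) = 1 - measure M (\<Union>j<n. X j)"
    using prob_compl[OF U] M by (simp add: valuation_def)
  ultimately show ?thesis using valuation_measure_finite[OF M fin] by simp
qed

text \<open>By envy-freeness the own piece is a largest of \<open>n\<close> values with sum 1, hence
  at least their average.\<close>

lemma envy_free_complete_util_ge:
  assumes v: "cake_instance n v" and X: "division n X" "complete_div n X" "envy_free n v X" and i: "i < n"
  shows "1 / real n \<le> util v X i i"
proof -
  have "1 = (\<Sum>j<n. util v X i j)"
    using complete_div_measure_sum[OF _ X(1,2), of "v i"] v i by (simp add: cake_instance_def util_def)
  also have "\<dots> \<le> (\<Sum>j<n. util v X i i)"
    using X(3) i by (intro sum_mono) (auto simp: envy_free_def)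
  finally show ?thesis using i by (simp add: field_simps)
qed

lemma eg_le: "i < n \<Longrightarrow> eg n v X \<le> util v X i i"
  unfolding eg_def by (intro Min_le) auto

lemma le_eg: "0 < n \<Longrightarrow> (\<And>i. i < n \<Longrightarrow> c \<le> util v X i i) \<Longrightarrow> c \<le> eg n v X"
  unfolding eg_def by (intro Min.boundedI) auto

text \<open>The strict \<open>a i < b i\<close> matters: the closure of an empty open interval is
  empty and would not contain its end point.\<close>

lemma complete_divI:
  assumes X: "\<And>i. i < n \<Longrightarrow> X i = {a i<..<b i} \<and> 0 \<le> a i \<and> a i < b i \<and> b i \<le> 1"
    and cover: "\<And>t. 0 \<le> t \<Longrightarrow> t \<le> 1 \<Longrightarrow> \<exists>i<n. a i \<le> t \<and> t \<le> b i"
  shows "complete_div n X"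
proof -
  have cl: "closure (X i) = {a i..b i}" if "i < n" for i using X[OF that] by simp
  show ?thesis unfolding complete_div_def
  proof (intro equalityI subsetI)
    fix t assume "t \<in> (\<Union>i<n. closure (X i))"
    then obtain i where i: "i < n" "t \<in> closure (X i)" by blast
    then have "t \<in> {a i..b i}" using cl by blast
    then show "t \<in> {0..1}" using X[OF i(1)] by auto
  next
    fix t :: real assume "t \<in> {0..1}"
    then obtain i where i: "i < n" "t \<in> {a i..b i}" using cover[of t] by auto
    then have "t \<in> closure (X i)" using cl by blast
    then show "t \<in> (\<Union>i<n. closure (X i))" using i(1) by blast
  qed
qed

lemma consecutive_interval_cover:
  fixes c :: "nat \<Rightarrow> real"
  assumes "c 0 \<le> t" "t \<le> c (Suc m)"
  shows "\<exists>k\<le>m. c k \<le> t \<and> t \<le> c (Suc k)"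
  using assms
proof (induction m)
  case (Suc m)
  then show ?case by (cases "t \<le> c (Suc m)") (use le_Suc_eq in auto)
qed auto

theorem envy_free_complete_division_exists:
  assumes n: "1 \<le> n" and v: "cake_instance n v"
  obtains X where "division n X" "complete_div n X" "envy_free n v X"
proof -
  obtain m where m: "n = Suc m" using n by (cases n) auto
  \<comment> \<open>Stick breaking: piece \<open>l\<close> takes the fraction \<open>y l\<close> of what is left, and piece \<open>m\<close> the rest. So
    \<open>y l = 0\<close> empties piece \<open>l\<close> and \<open>y l = 1\<close> all later ones: exactly the boundary behaviour that
    Kuhn's lemma requires of a labelling.\<close>
  define r where "r y l = (if l < m then 1 - y l else 0)" for y :: "nat \<Rightarrow> real" and l
  define cut where "cut y k = 1 - (\<Prod>l<k. r y l)" for y :: "nat \<Rightarrow> real" and k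
  have r: "0 \<le> r y l" "r y l \<le> 1" if "\<forall>j. y j \<in> {0..1}" for y l using that by (auto simp: r_def)
  have cut_0: "cut y 0 = 0" for y by (simp add: cut_def)
  have cut_m: "cut y (Suc m) = 1" for y by (simp add: cut_def r_def)
  have cut_Suc: "cut y k \<le> cut y (Suc k)" if "\<forall>j. y j \<in> {0..1}" for y k
    using r[OF that] by (simp add: cut_def mult_left_le prod_nonneg)
  have cut_mono: "cut y k \<le> cut y l" if "\<forall>j. y j \<in> {0..1}" "k \<le> l" for y k l
    using cut_Suc[OF that(1)] that(2) by (rule lift_Suc_mono_le)
  have cut_range: "0 \<le> cut y k" "k \<le> Suc m \<Longrightarrow> cut y k \<le> 1" if "\<forall>j. y j \<in> {0..1}" for y k
    using cut_mono[OF that, of 0 k] cut_mono[OF that, of k "Suc m"] cut_0[of y] cut_m[of y] by auto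
  have cut_cont: "continuous_on UNIV (\<lambda>y. cut y k)" for k
  proof -
    have "continuous_on UNIV (\<lambda>y. r y l)" for l
      unfolding r_def by (cases "l < m") (auto intro!: continuous_intros)
    then show ?thesis unfolding cut_def by (intro continuous_intros)
  qed
  have "\<exists>F. continuous_on UNIV F \<and> F 0 = 0 \<and> F 1 = 1 \<and>
      (\<forall>a b. 0 \<le> a \<longrightarrow> a \<le> b \<longrightarrow> b \<le> 1 \<longrightarrow> measure (v i) {a<..<b} = F b - F a)" if "i < n" for i
  proof -
    have val: "valuation (v i)" using v that by (simp add: cake_instance_def)
    obtain G where "continuous_on UNIV G" "G 0 = 0" "G 1 = 1"
      "\<And>a b. 0 \<le> a \<Longrightarrow> a \<le> b \<Longrightarrow> b \<le> 1 \<Longrightarrow> measure (v i) {a<..<b} = G b - G a"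
      by (rule valuation_cdf[OF val], rule that)
    then show ?thesis by blast
  qed
  then obtain F :: "nat \<Rightarrow> real \<Rightarrow> real" where F: "\<And>i. i < n \<Longrightarrow> continuous_on UNIV (F i)"
      "\<And>i. i < n \<Longrightarrow> F i 0 = 0" "\<And>i. i < n \<Longrightarrow> F i 1 = 1"
    and measure_F: "\<And>i a b. i < n \<Longrightarrow> 0 \<le> a \<Longrightarrow> a \<le> b \<Longrightarrow> b \<le> 1 \<Longrightarrow> measure (v i) {a<..<b} = F i b - F i a"
    by metis
  \<comment> \<open>Differences of distribution functions, unlike measures of intervals, stay
    continuous for \<open>y\<close> outside the cube, where the cuts may be out of order.\<close>
  define u where "u i k y = F i (cut y (Suc k)) - F i (cut y k)" for i k and y :: "nat \<Rightarrow> real"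
  have u_sum: "(\<Sum>k\<le>m. u i k y) = 1" if "i \<le> m" for i y
    using that F(2,3)[of i] sum_lessThan_telescope[of "\<lambda>k. F i (cut y k)" "Suc m"]
    by (simp add: u_def m cut_0 cut_m lessThan_Suc_atMost del: sum.lessThan_Suc)
  have u_pos: "\<exists>k\<le>m. 0 < u i k y" if "i \<le> m" "\<forall>j. y j \<in> {0..1}" for i y
  proof (rule ccontr)
    assume "\<not> ?thesis"
    then have "(\<Sum>k\<le>m. u i k y) \<le> 0" by (intro sum_nonpos) (auto simp: not_less)
    then show False using u_sum[OF that(1)] by simp
  qed
  have u_cont: "continuous_on UNIV (u i k)" if "i \<le> m" "k \<le> m" for i k
  proof -
    have "continuous_on UNIV (\<lambda>y. F i (cut y l))" for l
      using F(1)[of i] that m by (intro continuous_on_compose2[OF _ cut_cont]) auto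
    then show ?thesis unfolding u_def by (intro continuous_on_diff)
  qed
  have u_zero: "u i j y \<le> 0" if "i \<le> m" "\<forall>j. y j \<in> {0..1}" "j < m" "y j = 0" for i y j
    using that(3,4) by (simp add: u_def cut_def r_def)
  have u_one: "u i k y \<le> 0"
    if "i \<le> m" "\<forall>j. y j \<in> {0..1}" "y j = 1" "j < k" "k \<le> m" for i y j k
  proof -
    have P: "(\<Prod>l<k. r y l) = 0" using that(3,4) by (intro prod_zero bexI[of _ j]) (auto simp: r_def)
    have "cut y k = 1" "cut y (Suc k) = 1" unfolding cut_def prod.lessThan_Suc P by simp_all
    then show ?thesis by (simp add: u_def)
  qed
  obtain y \<pi> where y: "\<forall>j. y j \<in> {0..1}" and \<pi>: "bij_betw \<pi> {..m} {..m}"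
    and best: "\<forall>i\<le>m. \<forall>k\<le>m. u i k y \<le> u i (\<pi> i) y"
    by (rule envy_free_point_exists[OF u_cont u_pos u_zero u_one])
  have \<pi>_le: "\<pi> i \<le> m" if "i < n" for i using that \<pi> by (auto simp: m bij_betw_def)
  define X where "X i = {cut y (\<pi> i)<..<cut y (Suc (\<pi> i))}" for i
  have meas: "util v X i j = u i (\<pi> j) y" if "i < n" "j < n" for i j
    using that measure_F[of i] cut_Suc[OF y] cut_range[OF y] \<pi>_le[of j] by (simp add: util_def X_def u_def)
  \<comment> \<open>A favourite piece has positive value, so none is empty;
    \<open>complete_divI\<close> needs this.\<close>
  have nonempty: "cut y (\<pi> i) < cut y (Suc (\<pi> i))" if "i < n" for i
  proof (rule ccontr)
    assume "\<not> ?thesis"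
    then have "u i (\<pi> i) y = 0" using cut_Suc[OF y, of "\<pi> i"] by (simp add: u_def)
    moreover have "i \<le> m" using that by (simp add: m)
    ultimately show False using u_pos[OF _ y, of i] best by fastforce
  qed
  have div: "division n X"
    unfolding division_def
  proof (intro conjI allI impI)
    show "\<exists>a b. 0 \<le> a \<and> a \<le> b \<and> b \<le> 1 \<and> X i = {a<..<b}" if "i < n" for i
      using cut_range[OF y] cut_Suc[OF y] \<pi>_le[OF that] unfolding X_def by blast
    show "X i \<inter> X j = {}" if ij: "i < n" "j < n" "i \<noteq> j" for i j
    proof -
      have "\<pi> i \<noteq> \<pi> j" using ij \<pi> by (auto simp: m bij_betw_def inj_on_def less_Suc_eq_le)
      then show ?thesis
        using cut_mono[OF y, of "Suc (\<pi> i)" "\<pi> j"] cut_mono[OF y, of "Suc (\<pi> j)" "\<pi> i"]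
        by (cases "\<pi> i < \<pi> j") (auto simp: X_def)
    qed
  qed
  have "complete_div n X"
  proof (rule complete_divI)
    show "X i = {cut y (\<pi> i)<..<cut y (Suc (\<pi> i))} \<and> 0 \<le> cut y (\<pi> i)
        \<and> cut y (\<pi> i) < cut y (Suc (\<pi> i)) \<and> cut y (Suc (\<pi> i)) \<le> 1" if "i < n" for i
      using cut_range[OF y] \<pi>_le[OF that] nonempty[OF that] by (auto simp: X_def)
    show "\<exists>i<n. cut y (\<pi> i) \<le> t \<and> t \<le> cut y (Suc (\<pi> i))" if t: "0 \<le> t" "t \<le> 1" for t
    proof -
      obtain k where k: "k \<le> m" "cut y k \<le> t" "t \<le> cut y (Suc k)"
        using consecutive_interval_cover[of "cut y" t m] t cut_0[of y] cut_m[of y] by auto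
      then obtain i where "i \<le> m" "\<pi> i = k" using \<pi> by (metis atMost_iff bij_betw_def imageE)
      then show ?thesis using k m by (intro exI[of _ i]) simp
    qed
  qed
  moreover have "envy_free n v X"
    unfolding envy_free_def using meas best \<pi>_le by (simp add: m less_Suc_eq_le)
  ultimately show ?thesis using div that by blast
qed

text \<open>Every piece is stretched to the right up to the next piece, and the leftmost one also to \<open>0\<close>.\<close>

lemma division_extend_complete:
  assumes n: "0 < n" and Y: "division n Y" and ne: "\<And>i. i < n \<Longrightarrow> Y i \<noteq> {}"
  obtains X where "division n X" "complete_div n X" "\<And>i. i < n \<Longrightarrow> Y i \<subseteq> X i"
proof -
  obtain a b where ab: "\<And>i. i < n \<Longrightarrow> 0 \<le> a i \<and> a i \<le> b i \<and> b i \<le> 1 \<and> Y i = {a i<..<b i}"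
    by (rule divisionE[OF Y], rule that)
  have lt: "a i < b i" if "i < n" for i using ab[OF that] ne[OF that] by auto
  have sep: "b i \<le> a j \<or> b j \<le> a i" if "i < n" "j < n" "i \<noteq> j" for i j
  proof (rule ccontr)
    assume "\<not> ?thesis"
    then have "max (a i) (a j) < min (b i) (b j)" using lt that by auto
    then obtain t where "max (a i) (a j) < t" "t < min (b i) (b j)" using dense by blast
    then have "t \<in> Y i \<inter> Y j" using ab that by auto
    then show False using Y that unfolding division_def by blast
  qed
  define low where "low = Min (a ` {..<n})"
  have low: "low \<le> a i" if "i < n" for i using that unfolding low_def by (intro Min_le) auto
  have low_in: "\<exists>i<n. a i = low"
  proof -
    have "low \<in> a ` {..<n}" unfolding low_def using n by (intro Min_in) auto
    then show ?thesis by auto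
  qed
  define a' where "a' i = (if a i = low then 0 else a i)" for i
  \<comment> \<open>The inserted 1 serves the rightmost piece, which has no successor.\<close>
  define b' where "b' i = Min (insert 1 (a ` {j. j < n \<and> b i \<le> a j}))" for i
  have b'_le: "b' i \<le> a j" if "j < n" "b i \<le> a j" for i j
    using that unfolding b'_def by (intro Min_le) auto
  have b'_1: "b' i \<le> 1" for i unfolding b'_def by (intro Min_le) auto
  have b'_ge: "b i \<le> b' i" if "i < n" for i
    using ab[OF that] unfolding b'_def by (intro Min.boundedI) auto
  have b'_in: "b' i = 1 \<or> (\<exists>j<n. b i \<le> a j \<and> b' i = a j)" for i
  proof -
    have "b' i \<in> insert 1 (a ` {j. j < n \<and> b i \<le> a j})" unfolding b'_def by (intro Min_in) auto
    then show ?thesis by auto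
  qed
  have a': "0 \<le> a' i" "a' i \<le> a i" if "i < n" for i using ab[OF that] by (auto simp: a'_def)
  have lt': "a' i < b' i" if "i < n" for i using a'[OF that] b'_ge[OF that] lt[OF that] by simp
  \<comment> \<open>A piece with another one to its left is not the lowest, so its left end was not
    moved to 0.\<close>
  have sep': "b' i \<le> a' j" if "i < n" "j < n" "b i \<le> a j" for i j
  proof -
    have "low < a j" using low[OF that(1)] lt[OF that(1)] that(3) by simp
    then show ?thesis using b'_le[of j i] that by (simp add: a'_def)
  qed
  define X where "X i = {a' i<..<b' i}" for i
  have "division n X"
    unfolding division_def
  proof (intro conjI allI impI)
    show "\<exists>a b. 0 \<le> a \<and> a \<le> b \<and> b \<le> 1 \<and> X i = {a<..<b}" if "i < n" for i
      using a'(1)[OF that] lt'[OF that] b'_1[of i] by (intro exI[of _ "a' i"] exI[of _ "b' i"]) (auto simp: X_def)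
    show "X i \<inter> X j = {}" if "i < n" "j < n" "i \<noteq> j" for i j
      using sep[OF that] sep'[of i j] sep'[of j i] that by (auto simp: X_def)
  qed
  moreover have "complete_div n X"
  proof (rule complete_divI[of _ _ a' b'])
    show "X i = {a' i<..<b' i} \<and> 0 \<le> a' i \<and> a' i < b' i \<and> b' i \<le> 1" if "i < n" for i
      using a'(1)[OF that] lt'[OF that] b'_1[of i] by (auto simp: X_def)
    show "\<exists>i<n. a' i \<le> t \<and> t \<le> b' i" if t: "0 \<le> t" "t \<le> 1" for t
    proof -
      \<comment> \<open>The point \<open>t\<close> lies in the piece with the largest left end not
        beyond \<open>t\<close>: if \<open>t\<close> passed its right end, another piece would start
        at that end, still before \<open>t\<close>.\<close>
      let ?J = "{j. j < n \<and> a' j \<le> t}"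
      obtain i0 where "i0 < n" "a i0 = low" using low_in by auto
      then have "i0 \<in> ?J" using t by (auto simp: a'_def)
      then have J: "finite (a' ` ?J)" "a' ` ?J \<noteq> {}" by auto
      obtain i where "Max (a' ` ?J) = a' i" "i \<in> ?J" using Max_in[OF J] by (rule imageE)
      then have i: "i < n" "a' i \<le> t" "a' i = Max (a' ` ?J)" by auto
      have max: "a' j \<le> a' i" if "j < n" "a' j \<le> t" for j
        using Max_ge[OF J(1), of "a' j"] i(3) that by auto
      have "t \<le> b' i"
      proof (rule ccontr)
        assume "\<not> t \<le> b' i"
        then obtain j where j: "j < n" "b i \<le> a j" "b' i = a j" "a j < t"
          using b'_in[of i] t(2) by auto
        have "a' i < b' i" using lt'[OF i(1)] .
        also have "\<dots> \<le> a' j" using sep'[of i j] i j by simp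
        also have "\<dots> \<le> a' i" using max[of j] a'(2)[of j] j by simp
        finally show False by simp
      qed
      then show ?thesis using i by auto
    qed
  qed
  moreover have "Y i \<subseteq> X i" if "i < n" for i
    using ab[OF that] a'(2)[OF that] b'_ge[OF that] by (auto simp: X_def)
  ultimately show ?thesis using that by blast
qed

theorem eg_dumping_paradox_upper_bound:
  assumes n: "1 \<le> n" and v: "cake_instance n v" and par: "eg_dumping_paradox n v \<alpha>"
  shows "\<alpha> \<le> real n / 2"
proof -
  obtain Y where \<alpha>: "1 < \<alpha>" and Y: "division n Y" "envy_free n v Y"
    and le: "\<And>X. division n X \<Longrightarrow> complete_div n X \<Longrightarrow> envy_free n v X \<Longrightarrow> \<alpha> * eg n v X \<le> eg n v Y"
    using par unfolding eg_dumping_paradox_def by blast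
  have val: "valuation (v i)" if "i < n" for i using v that by (simp add: cake_instance_def)
  have "eg n v Y < 1 / 2"
  proof (rule ccontr)
    assume "\<not> eg n v Y < 1 / 2"
    then have half: "1 / 2 \<le> util v Y i i" if "i < n" for i using eg_le[OF that, of v Y] by simp
    then have "Y i \<noteq> {}" if "i < n" for i using that by (force simp: util_def)
    then obtain X where X: "division n X" "complete_div n X" and sub: "\<And>i. i < n \<Longrightarrow> Y i \<subseteq> X i"
      using division_extend_complete[of n Y] Y n by auto
    have mono: "util v Y i i \<le> util v X i i" if "i < n" for i
    proof -
      interpret prob_space "v i" using val[OF that] by (simp add: valuation_def)
      show ?thesis unfolding util_def
        using sub[OF that] division_sets[OF val[OF that] X(1) that] by (intro finite_measure_mono)
    qed
    \<comment> \<open>A piece worth at least one half leaves at most one half for any other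
      piece.\<close>
    have "util v X i j \<le> util v X i i" if ij: "i < n" "j < n" "i \<noteq> j" for i j
    proof -
      have "util v X i i + util v X i j = (\<Sum>l\<in>{i, j}. util v X i l)" using ij by simp
      also have "\<dots> \<le> (\<Sum>l<n. util v X i l)" using ij by (intro sum_mono2) (auto simp: util_def)
      also have "\<dots> = 1" using complete_div_measure_sum[OF val[OF ij(1)] X] by (simp add: util_def)
      finally show ?thesis using half[OF ij(1)] mono[OF ij(1)] by simp
    qed
    then have "envy_free n v X" unfolding envy_free_def by (metis order_refl)
    then have "\<alpha> * eg n v X \<le> eg n v Y" using le X by blast
    also have "eg n v Y \<le> eg n v X"
      using n order_trans[OF eg_le mono] by (intro le_eg) auto
    finally have "(\<alpha> - 1) * eg n v X \<le> 0" by (simp add: algebra_simps)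
    moreover have "1 / 2 \<le> eg n v X"
      using n order_trans[OF half mono] by (intro le_eg) auto
    ultimately show False using \<alpha> by (simp add: mult_le_0_iff)
  qed
  obtain X where X: "division n X" "complete_div n X" "envy_free n v X"
    using envy_free_complete_division_exists[OF n v] .
  have "1 / real n \<le> eg n v X"
    using envy_free_complete_util_ge[OF v X] n by (intro le_eg) auto
  then have "\<alpha> * (1 / real n) \<le> \<alpha> * eg n v X" using \<alpha> by (intro mult_left_mono) auto
  also have "\<dots> \<le> eg n v Y" using le X by blast
  finally have "\<alpha> * (1 / real n) < 1 / 2" using \<open>eg n v Y < 1 / 2\<close> by linarith
  then show ?thesis using n by (simp add: field_simps)
qed

subsection \<open>Valuations with densities constant on cells\<close>

definition cell :: "nat \<Rightarrow> nat \<Rightarrow> real set" where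
  "cell N c = {real c / real N<..<(real c + 1) / real N}"

text \<open>A cell has length \<open>1 / N\<close>, so the factor \<open>N\<close> gives cell
  \<open>c\<close> the mass \<open>w c\<close>.\<close>

definition step_measure :: "nat \<Rightarrow> (nat \<Rightarrow> real) \<Rightarrow> real measure" where
  "step_measure N w = density (restrict_space lborel {0..1})
     (\<lambda>x. \<Sum>c<N. ennreal (real N * w c) * indicator (cell N c) x)"

lemma space_step_measure: "space (step_measure N w) = {0..1}"
  by (simp add: step_measure_def space_restrict_space)

lemma sets_step_measure: "sets (step_measure N w) = sets (restrict_space borel {0..1})"
  by (simp add: step_measure_def sets_restrict_space)

lemma cell_borel: "cell N c \<in> sets borel"
  by (simp add: cell_def)

lemma cell_pos: "x \<in> cell N c \<Longrightarrow> 0 < x"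
  by (rule order.strict_trans1[of 0 "real c / real N"]) (simp_all add: cell_def)

lemma emeasure_step_measure:
  assumes w: "\<And>c. 0 \<le> w c" and A: "A \<in> sets borel" "A \<subseteq> {0..1}"
  shows "emeasure (step_measure N w) A
    = ennreal (\<Sum>c<N. real N * w c * measure lborel (A \<inter> cell N c))"
proof -
  let ?f = "\<lambda>x. \<Sum>c<N. ennreal (real N * w c) * indicator (cell N c) x"
  have A': "A \<in> sets (restrict_space lborel {0..1})"
    using A by (auto simp: sets_restrict_space)
  have "?f \<in> borel_measurable lborel"
    using cell_borel by (intro borel_measurable_sum borel_measurable_times borel_measurable_indicator) auto
  then have f: "?f \<in> borel_measurable (restrict_space lborel {0..1})"
    by (rule measurable_restrict_space1)
  have fin: "emeasure lborel (A \<inter> cell N c) = ennreal (measure lborel (A \<inter> cell N c))" for c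
  proof -
    have "emeasure lborel (A \<inter> cell N c) \<le> emeasure lborel (cell N c)"
      using cell_borel by (intro emeasure_mono) auto
    also have "\<dots> < \<infinity>" by (intro emeasure_bounded_finite) (simp add: cell_def)
    finally show ?thesis by (intro emeasure_eq_ennreal_measure) auto
  qed
  have "emeasure (step_measure N w) A
      = (\<integral>\<^sup>+x. ?f x * indicator A x \<partial>restrict_space lborel {0..1})"
    unfolding step_measure_def by (rule emeasure_density[OF f A'])
  also have "\<dots> = (\<integral>\<^sup>+x. ?f x * indicator A x * indicator {0..1} x \<partial>lborel)"
    by (rule nn_integral_restrict_space) simp
  also have "\<dots> = (\<integral>\<^sup>+x. (\<Sum>c<N. ennreal (real N * w c) * indicator (A \<inter> cell N c) x) \<partial>lborel)"
    using A(2) by (intro nn_integral_cong)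
      (auto simp: sum_distrib_right indicator_def intro!: sum.cong)
  also have "\<dots> = (\<Sum>c<N. ennreal (real N * w c) * emeasure lborel (A \<inter> cell N c))"
    using A(1) cell_borel by (subst nn_integral_sum) (auto simp: nn_integral_cmult_indicator)
  also have "\<dots> = (\<Sum>c<N. ennreal (real N * w c * measure lborel (A \<inter> cell N c)))"
    using w by (simp add: fin ennreal_mult)
  also have "\<dots> = ennreal (\<Sum>c<N. real N * w c * measure lborel (A \<inter> cell N c))"
    using w by (intro sum_ennreal) (auto intro!: mult_nonneg_nonneg)
  finally show ?thesis .
qed

lemma measure_step_measure:
  assumes "\<And>c. 0 \<le> w c" "A \<in> sets borel" "A \<subseteq> {0..1}"
  shows "measure (step_measure N w) A = (\<Sum>c<N. real N * w c * measure lborel (A \<inter> cell N c))"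
  unfolding measure_def emeasure_step_measure[OF assms]
  using assms(1) by (intro enn2real_ennreal sum_nonneg) (auto intro!: mult_nonneg_nonneg simp: measure_def)

lemma measure_lborel_Ioo_max: "measure lborel {a<..<b} = max 0 (b - a)" for a b :: real
  by (cases "a \<le> b") auto

text \<open>The share of cell \<open>c\<close> covered by a piece, with the end points scaled by
  \<open>N\<close> so that cells have length 1.\<close>

definition overlap :: "real \<Rightarrow> real \<Rightarrow> nat \<Rightarrow> real" where
  "overlap x y c = max 0 (min y (real c + 1) - max x (real c))"

lemma overlap_bounds: "0 \<le> overlap x y c" "overlap x y c \<le> 1"
  by (auto simp: overlap_def)

lemma overlap_nonzeroD: "overlap x y c \<noteq> 0 \<Longrightarrow> x < real c + 1 \<and> real c < y"
  by (auto simp: overlap_def max_def min_def split: if_splits)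

lemma overlap_ge_1_iff: "1 \<le> overlap x y c \<longleftrightarrow> x \<le> real c \<and> real c + 1 \<le> y"
  by (auto simp: overlap_def max_def min_def split: if_splits)

lemma measure_step_measure_Ioo:
  assumes N: "0 < N" and w: "\<And>c. 0 \<le> w c" and ab: "0 \<le> a" "b \<le> 1"
  shows "measure (step_measure N w) {a<..<b}
    = (\<Sum>c<N. w c * overlap (real N * a) (real N * b) c)"
proof -
  have "{a<..<b} \<inter> cell N c = {max a (real c / N)<..<min b ((real c + 1) / N)}" for c
    by (auto simp: cell_def)
  moreover have "real N * max 0 (min b ((real c + 1) / N) - max a (real c / N))
      = overlap (real N * a) (real N * b) c" for c
    using N by (simp add: overlap_def max_mult_distrib_left min_mult_distrib_left right_diff_distrib)
  ultimately have "real N * w c * measure lborel ({a<..<b} \<inter> cell N c)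
      = w c * overlap (real N * a) (real N * b) c" for c
    by (metis (no_types, opaque_lifting) measure_lborel_Ioo_max mult.assoc mult.commute)
  then have "(\<Sum>c<N. real N * w c * measure lborel ({a<..<b} \<inter> cell N c))
      = (\<Sum>c<N. w c * overlap (real N * a) (real N * b) c)" by (simp only:)
  then show ?thesis using ab by (subst measure_step_measure[OF w]) auto
qed

text \<open>Nonatomicity comes from the intermediate value theorem. The mass of \<open>A\<close> to
  the left of \<open>t\<close> is Lipschitz in \<open>t\<close> with constant \<open>N\<close>, as
  the weights sum to 1; it rises from 0 to the mass of \<open>A\<close>, so some \<open>t\<close>
  cuts \<open>A\<close> in half.\<close>

lemma valuation_step_measure:
  assumes N: "0 < N" and w: "\<And>c. 0 \<le> w c" and sum: "(\<Sum>c<N. w c) = 1"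
  shows "valuation (step_measure N w)"
proof -
  let ?M = "step_measure N w"
  have in_sets: "A \<in> sets ?M \<longleftrightarrow> A \<in> sets borel \<and> A \<subseteq> {0..1}" for A
    by (auto simp: sets_step_measure sets_restrict_space)
  have "measure lborel ({0..1} \<inter> cell N c) = 1 / N" if "c < N" for c
  proof -
    have "cell N c \<subseteq> {0..1}"
    proof
      fix x assume x: "x \<in> cell N c"
      have "0 \<le> real c / N" by simp
      moreover have "(real c + 1) / N \<le> 1" using that N by (simp add: field_simps)
      moreover have "real c / N < x" "x < (real c + 1) / N" using x by (simp_all add: cell_def)
      ultimately show "x \<in> {0..1}" by (simp only: atLeastAtMost_iff) linarith
    qed
    then have "{0..1} \<inter> cell N c = cell N c" by blast
    then show ?thesis by (simp add: cell_def measure_lborel_Ioo_max diff_divide_distrib[symmetric])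
  qed
  then have "(\<Sum>c<N. real N * w c * measure lborel ({0..1} \<inter> cell N c)) = (\<Sum>c<N. w c)"
    using N by (intro sum.cong) auto
  then have "emeasure ?M (space ?M) = 1"
    using sum by (simp add: space_step_measure emeasure_step_measure[OF w])
  then have prob: "prob_space ?M" by (rule prob_spaceI)
  interpret prob_space ?M by (rule prob)
  have "\<exists>B\<in>sets ?M. B \<subseteq> A \<and> 0 < emeasure ?M B \<and> emeasure ?M B < emeasure ?M A"
    if A: "A \<in> sets ?M" and pos: "emeasure ?M A > 0" for A
  proof -
    define g where "g t = measure ?M (A \<inter> {..t})" for t
    have At: "A \<inter> {..t} \<in> sets ?M" for t using A by (auto simp: in_sets)
    have lip: "g t - g s \<le> real N * (t - s)" "g s \<le> g t" if "s \<le> t" for s t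
    proof -
      have Ast: "A \<inter> {s<..t} \<in> sets ?M" using A by (auto simp: in_sets)
      have "A \<inter> {..t} = (A \<inter> {..s}) \<union> (A \<inter> {s<..t})" using that by auto
      then have "g t = g s + measure ?M (A \<inter> {s<..t})"
        unfolding g_def using At Ast by (simp add: finite_measure_Union disjoint_iff)
      moreover have "measure lborel (A \<inter> {s<..t} \<inter> cell N c) \<le> t - s" for c
      proof -
        have "measure lborel (A \<inter> {s<..t} \<inter> cell N c) \<le> measure lborel {s..t}"
          using A cell_borel that
          by (intro measure_mono_fmeasurable) (auto simp: in_sets fmeasurable_compact intro!: sets.Int)
        then show ?thesis using that by simp
      qed
      then have "measure ?M (A \<inter> {s<..t}) \<le> (\<Sum>c<N. real N * w c * (t - s))"
        using Ast w by (subst measure_step_measure[OF w])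
          (auto simp: in_sets intro!: sum_mono mult_left_mono)
      moreover have "(\<Sum>c<N. real N * w c * (t - s)) = real N * (t - s)"
        using sum by (simp add: sum_distrib_left[symmetric] sum_distrib_right[symmetric])
      ultimately show "g t - g s \<le> real N * (t - s)" "g s \<le> g t" by auto
    qed
    have "continuous_on UNIV g"
    proof (rule lipschitz_on_continuous_on)
      show "(real N)-lipschitz_on UNIV g"
      proof (rule lipschitz_onI)
        show "dist (g x) (g y) \<le> real N * dist x y" for x y
          using lip[of x y] lip[of y x] by (cases "x \<le> y") (auto simp: dist_real_def)
      qed simp
    qed
    then have "continuous_on {0..1} g" by (rule continuous_on_subset) simp
    moreover have "g 0 = 0"
    proof -
      have "measure lborel (A \<inter> {..0} \<inter> cell N c) = 0" for c
      proof -
        have "A \<inter> {..0} \<inter> cell N c = {}" using cell_pos by fastforce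
        then show ?thesis by simp
      qed
      then show ?thesis
        using At[of 0] unfolding g_def in_sets by (subst measure_step_measure[OF w]) auto
    qed
    moreover have "A \<inter> {..1} = A" using A in_sets by auto
    then have g1: "g 1 = measure ?M A" by (simp add: g_def)
    have mpos: "0 < measure ?M A" using pos by (simp add: emeasure_eq_measure)
    ultimately obtain t where "0 \<le> t" "t \<le> 1" "g t = measure ?M A / 2"
      using IVT'[of g 0 "measure ?M A / 2" 1] g1 by auto
    then show ?thesis
      using At[of t] mpos by (intro bexI[of _ "A \<inter> {..t}"]) (auto simp: emeasure_eq_measure g_def ennreal_less_iff)
  qed
  then have "nonatomic ?M" unfolding nonatomic_def by blast
  then show ?thesis
    unfolding valuation_def using prob by (simp add: space_step_measure sets_step_measure)
qed

text \<open>Together with the lower bound after it, this replaces exact overlaps by finite sums: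
  cells merely touched count in full from above, only cells contained entirely count from
  below.\<close>

lemma measure_step_measure_le:
  assumes N: "0 < N" and w: "\<And>c. 0 \<le> w c" and ab: "0 \<le> a" "b \<le> 1" and J: "finite J"
    and cover: "\<And>c. c < N \<Longrightarrow> w c \<noteq> 0 \<Longrightarrow> real N * a < real c + 1 \<Longrightarrow> real c < real N * b \<Longrightarrow> c \<in> J"
  shows "measure (step_measure N w) {a<..<b} \<le> (\<Sum>c\<in>J. w c)"
proof -
  let ?L = "overlap (real N * a) (real N * b)"
  have "measure (step_measure N w) {a<..<b} = (\<Sum>c<N. w c * ?L c)"
    by (rule measure_step_measure_Ioo[OF N w ab])
  also have "\<dots> \<le> (\<Sum>c<N. if c \<in> J then w c else 0)"
  proof (rule sum_mono)
    fix c assume "c \<in> {..<N}"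
    then have "w c = 0 \<or> ?L c = 0 \<or> c \<in> J" using cover[of c] overlap_nonzeroD by blast
    moreover have "?L c \<le> 1" by (rule overlap_bounds)
    ultimately show "w c * ?L c \<le> (if c \<in> J then w c else 0)"
      using w[of c] mult_left_mono[of "?L c" 1 "w c"] by auto
  qed
  also have "\<dots> = (\<Sum>c\<in>{..<N} \<inter> J. w c)" by (simp add: sum.inter_restrict)
  also have "\<dots> \<le> (\<Sum>c\<in>J. w c)" using J w by (intro sum_mono2) auto
  finally show ?thesis .
qed

lemma measure_step_measure_ge:
  assumes N: "0 < N" and w: "\<And>c. 0 \<le> w c" and ab: "0 \<le> a" "b \<le> 1" and J: "J \<subseteq> {..<N}"
    and inside: "\<And>c. c \<in> J \<Longrightarrow> real N * a \<le> real c \<and> real c + 1 \<le> real N * b"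
  shows "(\<Sum>c\<in>J. w c) \<le> measure (step_measure N w) {a<..<b}"
proof -
  let ?L = "overlap (real N * a) (real N * b)"
  have "(\<Sum>c\<in>J. w c) = (\<Sum>c\<in>J. w c * ?L c)"
  proof (rule sum.cong)
    fix c assume "c \<in> J"
    then have "?L c = 1" using inside overlap_ge_1_iff overlap_bounds(2) by (metis antisym)
    then show "w c = w c * ?L c" by simp
  qed simp
  also have "\<dots> \<le> (\<Sum>c<N. w c * ?L c)" using J w overlap_bounds(1) by (intro sum_mono2) auto
  also have "\<dots> = measure (step_measure N w) {a<..<b}"
    by (rule measure_step_measure_Ioo[OF N w ab, symmetric])
  finally show ?thesis .
qed

text \<open>If only one valued cell is within reach, obtaining its whole value requires overlap 1.
  This later pins player \<open>3 * i\<close> to its remaining cell.\<close>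

lemma cell_inside_if_measure_step_measure_ge:
  assumes N: "0 < N" and w: "\<And>c. 0 \<le> w c" and ab: "0 \<le> a" "b \<le> 1" and d: "d < N" "0 < w d"
    and only: "\<And>c. c < N \<Longrightarrow> w c \<noteq> 0 \<Longrightarrow> real N * a < real c + 1 \<Longrightarrow> real c < real N * b \<Longrightarrow> c = d"
    and ge: "w d \<le> measure (step_measure N w) {a<..<b}"
  shows "real N * a \<le> real d \<and> real d + 1 \<le> real N * b"
proof -
  let ?L = "overlap (real N * a) (real N * b)"
  have "w d \<le> (\<Sum>c<N. w c * ?L c)"
    using ge by (simp only: measure_step_measure_Ioo[OF N w ab])
  also have "\<dots> = (\<Sum>c<N. if c = d then w d * ?L d else 0)"
    using only overlap_nonzeroD by (intro sum.cong) fastforce+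
  also have "\<dots> = w d * ?L d" using d by simp
  finally have "1 \<le> ?L d" using d(2) by simp
  then show ?thesis by (simp only: overlap_ge_1_iff)
qed

lemma measure_step_measure_cells:
  assumes N: "0 < N" and w: "\<And>c. 0 \<le> w c" and xy: "x \<le> y" "y \<le> N"
  shows "measure (step_measure N w) {real x / N<..<real y / N} = (\<Sum>c\<in>{x..<y}. w c)"
proof (rule antisym)
  have ab: "0 \<le> real x / N" "real y / N \<le> 1" using N xy by (auto simp: field_simps)
  have "c \<in> {x..<y}" if "real N * (real x / N) < real c + 1" "real c < real N * (real y / N)" for c
    using that N by simp
  then show "measure (step_measure N w) {real x / N<..<real y / N} \<le> (\<Sum>c\<in>{x..<y}. w c)"
    by (intro measure_step_measure_le[OF N w ab]) blast+
  show "(\<Sum>c\<in>{x..<y}. w c) \<le> measure (step_measure N w) {real x / N<..<real y / N}"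
    using N xy by (intro measure_step_measure_ge[OF N w ab]) auto
qed

subsection \<open>The dumping instance\<close>

definition spike :: "nat \<Rightarrow> real \<Rightarrow> nat \<Rightarrow> real" where
  "spike d v c = (if c = d then v else 0)"

lemma sum_spike: "finite A \<Longrightarrow> (\<Sum>c\<in>A. spike d v c) = (if d \<in> A then v else 0)"
  by (simp add: spike_def)

text \<open>Numbering the markers from left to right makes the cells strictly between two neighbours
  exactly one item.\<close>

definition marker :: "nat \<Rightarrow> nat \<Rightarrow> nat" where
  "marker k m = (if m < 2 * k then 9 * (m div 2) + 2 * (m mod 2) else 9 * k + 2 * (m - 2 * k))"

lemma marker_strict_mono: "strict_mono (marker k)"
proof (rule strict_monoI_Suc)
  fix m
  obtain j where "m = 2 * j \<or> m = Suc (2 * j)" by (metis oddE evenE Suc_eq_plus1)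
  then show "marker k m < marker k (Suc m)" by (auto simp: marker_def)
qed

lemma marker_even: "i < k \<Longrightarrow> marker k (2 * i) = 9 * i"
  and marker_odd: "i < k \<Longrightarrow> marker k (2 * i + 1) = 9 * i + 2"
  and marker_late: "marker k (2 * k + j) = 9 * k + 2 * j"
  by (simp_all add: marker_def)

text \<open>For the last block the next index falls into the other branch of \<open>marker\<close>,
  but the first late marker \<open>9 * k\<close> continues the same pattern.\<close>

lemma marker_odd_Suc: "i < k \<Longrightarrow> marker k (2 * i + 2) = 9 * i + 9"
  by (cases "Suc i = k") (auto simp: marker_def)

text \<open>Block \<open>i < k\<close> consists of the cells \<open>9i, \<dots>, 9i + 8\<close>: marker, first item \<open>9i + 1\<close>, marker, and the
  second item \<open>9i + 3, \<dots>, 9i + 8\<close>. Then follow \<open>k + 1\<close> markers alternating with the items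
  \<open>9k + 2i + 1\<close>. Player \<open>3k\<close> values the markers; players \<open>3i\<close>, \<open>3i + 1\<close>, \<open>3i + 2\<close> belong to block \<open>i\<close>
  and are meant to receive cell \<open>9i + 1\<close>, cells \<open>9i + 5, 9i + 6, 9i + 7\<close> and cell \<open>9i + 8\<close>. Cells
  \<open>9i + 3\<close> and \<open>9i + 4\<close> are discarded: the weight \<open>e\<close> there makes player \<open>3i + 1\<close> envy whoever adds
  the former to cell \<open>9i + 1\<close>, and player \<open>3i + 2\<close> whoever adds the latter to cell \<open>9i + 6\<close>.\<close>

definition weight :: "nat \<Rightarrow> real \<Rightarrow> nat \<Rightarrow> nat \<Rightarrow> real" where
  "weight k e p c =
    (let q = (1 - e) / 3; i = p div 3; t = 9 * k + 2 * i + 1 in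
     if p = 3 * k then (if c \<in> marker k ` {..3 * k} then 1 / real (3 * k + 1) else 0)
     else if p mod 3 = 0 then spike (9 * i + 1) (1 / 2) c + spike t (1 / 2) c
     else if p mod 3 = 1 then spike (9 * i + 1) q c + spike (9 * i + 3) e c
       + spike (9 * i + 5) (q / 2) c + spike (9 * i + 7) (q / 2) c + spike t q c
     else spike (9 * i + 4) e c + spike (9 * i + 6) q c + spike (9 * i + 8) q c + spike t q c)"

text \<open>The bound \<open>e < 1 / 7\<close> is equivalent to \<open>2 * e < q\<close>, that is,
  \<open>e + q / 2 < q\<close>: cells \<open>9 * i + 3\<close> and \<open>9 * i + 5\<close> together
  must not satisfy player \<open>3 * i + 1\<close>.\<close>

locale dumping_instance =
  fixes k :: nat and e :: real
  assumes k: "1 \<le> k" and e: "0 < e" "e < 1 / 7"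
begin

definition "N = 11 * k + 1"
abbreviation "n \<equiv> 3 * k + 1"
abbreviation "T i \<equiv> 9 * k + 2 * i + 1"
definition "q = (1 - e) / 3"
definition "v p = step_measure N (weight k e p)"

lemma q: "0 < q" "2 * e < q" "3 * q + e = 1" "q < 1 / 3"
  using e by (simp_all add: q_def field_simps)

lemma weight_last: "weight k e (3 * k) c = (if c \<in> marker k ` {..3 * k} then 1 / real n else 0)"
  by (simp add: weight_def)

lemma weight_0:
  assumes "i < k"
  shows "weight k e (3 * i) c = spike (9 * i + 1) (1 / 2) c + spike (T i) (1 / 2) c"
  using assms by (simp add: weight_def)

lemma weight_1:
  assumes "i < k"
  shows "weight k e (3 * i + 1) c = spike (9 * i + 1) q c + spike (9 * i + 3) e c
    + spike (9 * i + 5) (q / 2) c + spike (9 * i + 7) (q / 2) c + spike (T i) q c"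
proof -
  have "3 * i + 1 \<noteq> 3 * k" "(3 * i + 1) mod 3 = 1" "(3 * i + 1) div 3 = i" using assms by presburger+
  then show ?thesis unfolding weight_def Let_def q_def by (simp only: if_False if_True) simp
qed

lemma weight_2:
  assumes "i < k"
  shows "weight k e (3 * i + 2) c = spike (9 * i + 4) e c + spike (9 * i + 6) q c
    + spike (9 * i + 8) q c + spike (T i) q c"
proof -
  have "3 * i + 2 \<noteq> 3 * k" "(3 * i + 2) mod 3 = 2" "(3 * i + 2) div 3 = i" using assms by presburger+
  then show ?thesis unfolding weight_def Let_def q_def by (simp only: if_False if_True) simp
qed

lemma weight_0_vals:
  assumes "i < k"
  shows "weight k e (3 * i) (9 * i + 1) = 1 / 2" "weight k e (3 * i) (T i) = 1 / 2"
  using assms by (simp_all add: weight_0 spike_def)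

lemma weight_1_vals:
  assumes "i < k"
  shows "weight k e (3 * i + 1) (9 * i + 1) = q" "weight k e (3 * i + 1) (9 * i + 3) = e"
    "weight k e (3 * i + 1) (9 * i + 5) = q / 2" "weight k e (3 * i + 1) (9 * i + 7) = q / 2"
    "weight k e (3 * i + 1) (T i) = q"
  unfolding weight_1[OF assms] using assms by (simp_all add: spike_def)

lemma weight_2_vals:
  assumes "i < k"
  shows "weight k e (3 * i + 2) (9 * i + 4) = e" "weight k e (3 * i + 2) (9 * i + 6) = q"
    "weight k e (3 * i + 2) (9 * i + 8) = q" "weight k e (3 * i + 2) (T i) = q"
  unfolding weight_2[OF assms] using assms by (simp_all add: spike_def)

lemma weight_0_supp: "i < k \<Longrightarrow> weight k e (3 * i) c \<noteq> 0 \<Longrightarrow> c = 9 * i + 1 \<or> c = T i"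
  by (auto simp: weight_0 spike_def split: if_splits)

lemma weight_1_supp: "i < k \<Longrightarrow> weight k e (3 * i + 1) c \<noteq> 0 \<Longrightarrow>
    c = 9 * i + 1 \<or> c = 9 * i + 3 \<or> c = 9 * i + 5 \<or> c = 9 * i + 7 \<or> c = T i"
  unfolding weight_1 by (auto simp: spike_def split: if_splits)

lemma weight_2_supp: "i < k \<Longrightarrow> weight k e (3 * i + 2) c \<noteq> 0 \<Longrightarrow>
    c = 9 * i + 4 \<or> c = 9 * i + 6 \<or> c = 9 * i + 8 \<or> c = T i"
  unfolding weight_2 by (auto simp: spike_def split: if_splits)

lemma player_cases:
  assumes "p < n"
  obtains "p = 3 * k" | i where "i < k" "p = 3 * i" | i where "i < k" "p = 3 * i + 1"
    | i where "i < k" "p = 3 * i + 2"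
proof -
  have p: "p = 3 * (p div 3) \<or> p = 3 * (p div 3) + 1 \<or> p = 3 * (p div 3) + 2" by presburger
  show ?thesis
  proof (cases "p = 3 * k")
    case False
    then have "p div 3 < k" using assms by (simp add: less_mult_imp_div_less)
    then show ?thesis using p that(2-4)[of "p div 3"] by argo
  qed (rule that(1))
qed

lemma weight_nonneg: "0 \<le> weight k e p c"
proof -
  have s: "0 \<le> spike d x c" if "0 \<le> x" for d x using that by (simp add: spike_def)
  show ?thesis
    unfolding weight_def Let_def using e by (simp add: s)
qed

lemma marker_le: "m \<le> 3 * k \<Longrightarrow> marker k m < N"
proof (cases "m < 2 * k")
  case True
  then have "m div 2 < k" by (simp add: less_mult_imp_div_less)
  moreover have "m mod 2 < 2" by simp
  ultimately show ?thesis using True unfolding marker_def N_def by simp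
qed (simp add: marker_def N_def)

lemma weight_sum:
  assumes "p < n"
  shows "(\<Sum>c<N. weight k e p c) = 1"
  using assms
proof (cases rule: player_cases)
  case 1
  have "(\<Sum>c<N. weight k e p c) = (\<Sum>c\<in>{..<N} \<inter> marker k ` {..3 * k}. 1 / real n)"
    unfolding 1 weight_last by (rule sum.inter_restrict[symmetric]) simp
  also have "{..<N} \<inter> marker k ` {..3 * k} = marker k ` {..3 * k}" using marker_le by auto
  also have "(\<Sum>c\<in>marker k ` {..3 * k}. 1 / real n) = 1"
    using marker_strict_mono[of k] by (simp add: card_image strict_mono_imp_inj_on)
  finally show ?thesis .
next
  case (2 i)
  have "9 * i + 1 < N" "T i < N" using 2(1) by (simp_all add: N_def)
  then show ?thesis unfolding 2(2) weight_0[OF 2(1)] sum.distrib by (simp add: sum_spike)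
next
  case (3 i)
  have "9 * i + 1 < N" "9 * i + 3 < N" "9 * i + 5 < N" "9 * i + 7 < N" "T i < N"
    using 3(1) by (simp_all add: N_def)
  then show ?thesis unfolding 3(2) weight_1[OF 3(1)] sum.distrib using q(3) by (simp add: sum_spike)
next
  case (4 i)
  have "9 * i + 4 < N" "9 * i + 6 < N" "9 * i + 8 < N" "T i < N"
    using 4(1) by (simp_all add: N_def)
  then show ?thesis unfolding 4(2) weight_2[OF 4(1)] sum.distrib using q(3) by (simp add: sum_spike)
qed

lemma N_pos: "0 < N"
  by (simp add: N_def)

lemma cake_instance_v: "cake_instance n v"
  unfolding cake_instance_def v_def
  by (intro allI impI valuation_step_measure[OF N_pos weight_nonneg weight_sum])

end

section \<open>An arbitrary complete envy-free division of the instance\<close>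

locale complete_ef = dumping_instance +
  fixes X :: "nat \<Rightarrow> real set" and a b :: "nat \<Rightarrow> real"
  assumes X: "\<And>j. j < n \<Longrightarrow> 0 \<le> a j \<and> a j \<le> b j \<and> b j \<le> 1 \<and> X j = {a j<..<b j}"
    and div: "division n X" and complete: "complete_div n X" and ef: "envy_free n v X"
begin

abbreviation "u \<equiv> util v X"
\<comment> \<open>Endpoints are rescaled so that cell \<open>c\<close> becomes the interval from \<open>c\<close> to \<open>c + 1\<close>.\<close>
abbreviation "L j \<equiv> real N * a j"
abbreviation "R j \<equiv> real N * b j"

lemma real_N_pos: "0 < real N"
  using N_pos by simp

lemma envy: "i < n \<Longrightarrow> j < n \<Longrightarrow> u i j \<le> u i i"
  using ef unfolding envy_free_def by blast

lemma u_pos: "i < n \<Longrightarrow> 0 < u i i"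
  by (rule order.strict_trans2[OF _ envy_free_complete_util_ge[OF cake_instance_v div complete ef]]) simp_all

lemma u_le:
  assumes "j < n" "finite J"
    and "\<And>c. weight k e p c \<noteq> 0 \<Longrightarrow> L j < real c + 1 \<Longrightarrow> real c < R j \<Longrightarrow> c \<in> J"
  shows "u p j \<le> (\<Sum>c\<in>J. weight k e p c)"
proof -
  have X': "X j = {a j<..<b j}" "0 \<le> a j" "b j \<le> 1" using X[OF assms(1)] by blast+
  show ?thesis unfolding util_def v_def X'(1)
    by (rule measure_step_measure_le[OF N_pos weight_nonneg X'(2,3) assms(2) assms(3)])
qed

lemma u_ge:
  assumes "j < n" "J \<subseteq> {..<N}" and "\<And>c. c \<in> J \<Longrightarrow> L j \<le> real c \<and> real c + 1 \<le> R j"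
  shows "(\<Sum>c\<in>J. weight k e p c) \<le> u p j"
proof -
  have X': "X j = {a j<..<b j}" "0 \<le> a j" "b j \<le> 1" using X[OF assms(1)] by blast+
  show ?thesis unfolding util_def v_def X'(1)
    by (rule measure_step_measure_ge[OF N_pos weight_nonneg X'(2,3) assms(2) assms(3)])
qed

lemma cell_held:
  assumes "j < n" "d < N" "0 < weight k e p d"
    and "\<And>c. weight k e p c \<noteq> 0 \<Longrightarrow> L j < real c + 1 \<Longrightarrow> real c < R j \<Longrightarrow> c = d"
    and "weight k e p d \<le> u p j"
  shows "L j \<le> real d \<and> real d + 1 \<le> R j"
proof -
  have X': "X j = {a j<..<b j}" "0 \<le> a j" "b j \<le> 1" using X[OF assms(1)] by blast+
  have le: "weight k e p d \<le> measure (step_measure N (weight k e p)) {a j<..<b j}"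
    using assms(5) unfolding util_def v_def X'(1) .
  show ?thesis
    by (rule cell_inside_if_measure_step_measure_ge[where w = "weight k e p",
        OF N_pos weight_nonneg X'(2,3) assms(2,3) assms(4) le])
qed

text \<open>Proportionality excludes empty pieces. Hence disjoint pieces are linearly ordered,
  whereas an empty interval could have its end points inside another piece.\<close>

lemma LR: "j < n \<Longrightarrow> L j < R j"
proof -
  assume j: "j < n"
  have "a j \<noteq> b j" using u_pos[OF j] X[OF j] by (auto simp: util_def)
  then have "a j < b j" using X[OF j] by auto
  then show ?thesis by (rule mult_strict_left_mono[OF _ real_N_pos])
qed

lemma disj:
  assumes ij: "i < n" "j < n" "i \<noteq> j"
  shows "R i \<le> L j \<or> R j \<le> L i"
proof -
  have "a i < b i" "a j < b j" using LR[OF ij(1)] LR[OF ij(2)] real_N_pos mult_less_cancel_left_pos by blast+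
  have "b i \<le> a j \<or> b j \<le> a i"
  proof (rule ccontr)
    assume "\<not> ?thesis"
    then have "max (a i) (a j) < min (b i) (b j)"
      using \<open>a i < b i\<close> \<open>a j < b j\<close> by auto
    then obtain t where "max (a i) (a j) < t" "t < min (b i) (b j)" using dense by blast
    then have "t \<in> X i \<inter> X j" using X[OF ij(1)] X[OF ij(2)] by auto
    then show False using div ij unfolding division_def by blast
  qed
  then show ?thesis using real_N_pos mult_le_cancel_left_pos by blast
qed

lemma covered:
  assumes "0 \<le> t" "t \<le> real N"
  obtains j where "j < n" "L j \<le> t" "t \<le> R j"
proof -
  have "t / real N \<in> {0..1}" using assms real_N_pos by (simp add: divide_le_eq)
  then have "t / real N \<in> (\<Union>i<n. closure (X i))"
    using complete unfolding complete_div_def by (simp only:)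
  then obtain j where j: "j < n" "t / real N \<in> closure (X j)" by blast
  moreover have "closure (X j) \<subseteq> {a j..b j}"
    using X[OF j(1)] by (intro closure_minimal) auto
  ultimately have "a j \<le> t / real N" "t / real N \<le> b j" by auto
  then show ?thesis using that[OF j(1)] real_N_pos by (simp add: field_simps)
qed

text \<open>With the cells \<open>9i + 1\<close> and \<open>9k + 2i + 1\<close> lost to \<open>z\<close> and \<open>z'\<close>, players \<open>3i + 1\<close> and \<open>3i + 2\<close> must
  both get \<open>q\<close> from the second item of block \<open>i\<close>. This forces the former to the left of the latter, and
  cell \<open>9i + 4\<close> out of the piece of the former; by completeness \<open>z\<close> then holds cell \<open>9i + 3\<close> too.\<close>

lemma block_obstruction:
  assumes i: "i < k" and zz: "z = 3 * i \<and> z' = 3 * k \<or> z = 3 * k \<and> z' = 3 * i"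
    and p: "L z \<le> real (9 * i + 1)" "real (9 * i + 1) + 1 \<le> R z"
    and t: "L z' \<le> real (T i)" "real (T i) + 1 \<le> R z'"
  shows False
proof -
  let ?s = "3 * i + 1" and ?r = "3 * i + 2"
  note V1 = weight_1_vals[OF i, simplified] and V2 = weight_2_vals[OF i, simplified]
  have lt: "z < n" "z' < n" "?s < n" "?r < n" using zz i by auto
  have ne: "?s \<noteq> z" "?s \<noteq> z'" "?r \<noteq> z" "?r \<noteq> z'" using zz i by presburger+
  have ne': "z \<noteq> z'" using zz i by auto
  have cells: "9 * i + 8 < N" "T i < N" using i by (simp_all add: N_def)
  have ik: "real i + 1 \<le> real k" using i by simp
  \<comment> \<open>Envy of \<open>z\<close> and of \<open>z'\<close> raises the two players to
    \<open>q\<close>. Apart from this, only the distinctness of the players involved is used, so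
    both alternatives of \<open>zz\<close> are treated at once.\<close>
  have q_s: "q \<le> u ?s ?s"
  proof -
    have "(\<Sum>c\<in>{9 * i + 1}. weight k e ?s c) \<le> u ?s z"
      using lt p cells by (intro u_ge) auto
    then show ?thesis using envy[OF lt(3,1)] V1 by simp
  qed
  have q_r: "q \<le> u ?r ?r"
  proof -
    have "(\<Sum>c\<in>{T i}. weight k e ?r c) \<le> u ?r z'"
      using lt t cells by (intro u_ge) auto
    then show ?thesis using envy[OF lt(4,2)] V2 by simp
  qed
  have nt: "real (T i) + 1 \<le> L j \<or> R j \<le> real (T i)" if "j < n" "j \<noteq> z'" for j
    using disj[OF that(1) lt(2) that(2)] t by linarith
  have s_right: "R z \<le> L ?s"
  proof (rule ccontr)
    assume "\<not> ?thesis"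
    then have "R ?s \<le> L z" using disj[OF lt(3,1) ne(1)] by blast
    then have R: "R ?s \<le> 9 * real i + 1" using p(1) by simp
    have "u ?s ?s \<le> (\<Sum>c\<in>{}. weight k e ?s c)"
    proof (rule u_le[OF lt(3)])
      fix c assume c: "weight k e ?s c \<noteq> 0" "L ?s < real c + 1" "real c < R ?s"
      show "c \<in> {}" using weight_1_supp[OF i c(1)] c(3) R ik by auto
    qed simp
    then show False using q_s q(1) by simp
  qed
  have r_right: "R z \<le> L ?r"
  proof (rule ccontr)
    assume "\<not> ?thesis"
    then have "R ?r \<le> L z" using disj[OF lt(4,1) ne(3)] by blast
    then have R: "R ?r \<le> 9 * real i + 1" using p(1) by simp
    have "u ?r ?r \<le> (\<Sum>c\<in>{}. weight k e ?r c)"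
    proof (rule u_le[OF lt(4)])
      fix c assume c: "weight k e ?r c \<noteq> 0" "L ?r < real c + 1" "real c < R ?r"
      show "c \<in> {}" using weight_2_supp[OF i c(1)] c(3) R ik by auto
    qed simp
    then show False using q_r q(1) by simp
  qed
  have z_R: "9 * real i + 2 \<le> R z" using p(2) by simp
  \<comment> \<open>From \<open>9 * i + 6\<close> on only one half \<open>q / 2\<close> is left for
    \<open>?s\<close>, since the late cell belongs to \<open>z'\<close>.\<close>
  have s_low: "L ?s < 9 * real i + 6"
  proof (rule ccontr)
    assume "\<not> ?thesis"
    then have L: "9 * real i + 6 \<le> L ?s" by simp
    have "u ?s ?s \<le> (\<Sum>c\<in>{9 * i + 7}. weight k e ?s c)"
    proof (rule u_le[OF lt(3)])
      fix c assume c: "weight k e ?s c \<noteq> 0" "L ?s < real c + 1" "real c < R ?s"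
      show "c \<in> {9 * i + 7}" using weight_1_supp[OF i c(1)] c(2,3) L nt[OF lt(3) ne(2)] by auto
    qed simp
    then show False using q_s q(1) V1 by simp
  qed
  show False
  proof (cases "R ?r \<le> L ?s")
    case True
    then have R: "R ?r \<le> 9 * real i + 6" using s_low by simp
    have "u ?r ?r \<le> (\<Sum>c\<in>{9 * i + 4}. weight k e ?r c)"
    proof (rule u_le[OF lt(4)])
      fix c assume c: "weight k e ?r c \<noteq> 0" "L ?r < real c + 1" "real c < R ?r"
      show "c \<in> {9 * i + 4}" using weight_2_supp[OF i c(1)] c(2,3) R ik by auto
    qed simp
    then show False using q_r q(1,2) e V2 by simp
  next
    case False
    then have sr: "R ?s \<le> L ?r" using disj[OF lt(3,4)] by simp
    \<comment> \<open>Without reaching into cell \<open>9 * i + 7\<close>, \<open>?s\<close> gets at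
      most \<open>e + q / 2\<close>, which is less than \<open>q\<close>.\<close>
    have s_high: "9 * real i + 7 < R ?s"
    proof (rule ccontr)
      assume "\<not> ?thesis"
      then have R: "R ?s \<le> 9 * real i + 7" by simp
      have "u ?s ?s \<le> (\<Sum>c\<in>{9 * i + 3, 9 * i + 5}. weight k e ?s c)"
      proof (rule u_le[OF lt(3)])
        fix c assume c: "weight k e ?s c \<noteq> 0" "L ?s < real c + 1" "real c < R ?s"
        show "c \<in> {9 * i + 3, 9 * i + 5}"
          using weight_1_supp[OF i c(1)] c(2,3) R s_right z_R ik by auto
      qed simp
      then show False using q_s q(1,2) V1 by simp
    qed
    have "u ?r ?r \<le> (\<Sum>c\<in>{9 * i + 8}. weight k e ?r c)"
    proof (rule u_le[OF lt(4)])
      fix c assume c: "weight k e ?r c \<noteq> 0" "L ?r < real c + 1" "real c < R ?r"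
      show "c \<in> {9 * i + 8}"
        using weight_2_supp[OF i c(1)] c(2,3) sr s_high nt[OF lt(4) ne(4)] by auto
    qed simp
    then have r_le: "u ?r ?r \<le> q" using V2 by simp
    \<comment> \<open>Otherwise the piece of \<open>?s\<close> contains cells
      \<open>9 * i + 4\<close> and \<open>9 * i + 6\<close>, worth \<open>e + q\<close> to
      \<open>?r\<close>, who has at most \<open>q\<close>.\<close>
    have s_start: "9 * real i + 4 < L ?s"
    proof (rule ccontr)
      assume "\<not> ?thesis"
      then have "L ?s \<le> 9 * real i + 4" by simp
      then have "(\<Sum>c\<in>{9 * i + 4, 9 * i + 6}. weight k e ?r c) \<le> u ?r ?s"
        using lt s_high cells by (intro u_ge) auto
      then show False using envy[OF lt(4,3)] r_le V2 e by simp
    qed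
    have "u ?s ?s \<le> (\<Sum>c\<in>{9 * i + 5, 9 * i + 7}. weight k e ?s c)"
    proof (rule u_le[OF lt(3)])
      fix c assume c: "weight k e ?s c \<noteq> 0" "L ?s < real c + 1" "real c < R ?s"
      show "c \<in> {9 * i + 5, 9 * i + 7}"
        using weight_1_supp[OF i c(1)] c(2,3) s_start nt[OF lt(3) ne(2)] by auto
    qed simp
    then have s_le: "u ?s ?s \<le> q" using V1 by simp
    \<comment> \<open>A piece \<open>w\<close> between \<open>z\<close> and \<open>?s\<close> would
      be worthless to its owner: cells \<open>9 * i + 2\<close> to \<open>9 * i + 5\<close> are
      valued only by player \<open>3 * k\<close>, who is \<open>z\<close> or \<open>z'\<close>, and
      by \<open>?s\<close> and \<open>?r\<close>.\<close>
    have "L ?s \<le> R z"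
    proof (rule ccontr)
      assume gap: "\<not> ?thesis"
      obtain x where x: "R z < x" "x < L ?s" using gap dense by (metis not_le)
      have "0 \<le> x" "x \<le> real N" using x z_R s_low ik by (simp_all add: N_def)
      then obtain w where w: "w < n" "L w \<le> x" "x \<le> R w" by (rule covered)
      have w1: "w \<noteq> z" "w \<noteq> ?s" using w x by auto
      have w2: "w \<noteq> ?r" using w x sr LR[OF lt(3)] by auto
      have w3: "w \<noteq> z'"
      proof
        assume "w = z'"
        then have "L z' < R ?s" "L ?s < R z'"
          using w x s_low t ik LR[OF lt(3)] by auto
        then show False using disj[OF lt(2,3)] ne(2) by auto
      qed
      have wR: "R w \<le> L ?s" using disj[OF w(1) lt(3) w1(2)] w x LR[OF lt(3)] by linarith
      have wL: "R z \<le> L w" using disj[OF w(1) lt(1) w1(1)] w x LR[OF lt(1)] by linarith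
      have range: "9 * real i + 2 < real c + 1 \<and> real c < 9 * real i + 6"
        if "L w < real c + 1" "real c < R w" for c using that wR wL z_R s_low by linarith
      have "u w w \<le> (\<Sum>c\<in>{}. weight k e w c)"
      proof (rule u_le[OF w(1)])
        fix c assume c: "weight k e w c \<noteq> 0" "L w < real c + 1" "real c < R w"
        have c': "9 * i + 1 < c" "c < 9 * i + 6" using range[OF c(2,3)] by linarith+
        show "c \<in> {}"
          using w(1)
        proof (cases rule: player_cases)
          case 1
          then show ?thesis using w1 w3 zz by auto
        next
          case (2 j)
          have "j \<noteq> i" using 2 w1 w3 zz by auto
          then show ?thesis using weight_0_supp[OF 2(1)] c(1) c' i 2(2) by fastforce
        next
          case (3 j)
          have "j \<noteq> i" using 3 w1 by auto
          then show ?thesis using weight_1_supp[OF 3(1)] c(1) c' i 3(2) by fastforce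
        next
          case (4 j)
          have "j \<noteq> i" using 4 w2 by auto
          then show ?thesis using weight_2_supp[OF 4(1)] c(1) c' i 4(2) by fastforce
        qed
      qed simp
      then show False using u_pos[OF w(1)] by simp
    qed
    then have "9 * real i + 4 \<le> R z" using s_start by linarith
    then have "(\<Sum>c\<in>{9 * i + 1, 9 * i + 3}. weight k e ?s c) \<le> u ?s z"
      using lt p cells by (intro u_ge) auto
    then show False using envy[OF lt(3,1)] s_le V1 e by simp
  qed
qed

text \<open>One marker is worth exactly \<open>1 / n\<close>, so a larger value means touching two
  markers; an interval then contains everything between the first of them and its successor.\<close>

lemma last_player_contains_item:
  assumes big: "1 / real n < u (3 * k) (3 * k)"
  obtains i where "i < k" "L (3 * k) \<le> real (9 * i + 1)" "real (9 * i + 1) + 1 \<le> R (3 * k)"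
  | i where "i < k" "L (3 * k) \<le> real (9 * i + 3)" "real (9 * i + 8) + 1 \<le> R (3 * k)"
  | i where "i < k" "L (3 * k) \<le> real (T i)" "real (T i) + 1 \<le> R (3 * k)"
proof -
  let ?S = "3 * k"
  define J where "J = {m. m \<le> 3 * k \<and> L ?S < real (marker k m) + 1 \<and> real (marker k m) < R ?S}"
  have J: "finite J" by (rule finite_subset[of _ "{..3 * k}"]) (auto simp: J_def)
  have inj: "inj (marker k)" using marker_strict_mono by (rule strict_mono_imp_inj_on)
  have "u ?S ?S \<le> (\<Sum>c\<in>marker k ` J. weight k e ?S c)"
  proof (rule u_le)
    fix c assume "weight k e ?S c \<noteq> 0" "L ?S < real c + 1" "real c < R ?S"
    then show "c \<in> marker k ` J" by (auto simp: weight_last J_def split: if_splits)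
  qed (use J in auto)
  also have "\<dots> = (\<Sum>c\<in>marker k ` J. 1 / real n)"
    by (intro sum.cong) (auto simp: weight_last J_def)
  also have "\<dots> = card J / real n" using card_image[OF inj_on_subset[OF inj], of J] by simp
  finally have "1 / real n < real (card J) / real n" using big by linarith
  then have "1 < real (card J)" by (metis divide_right_mono not_less of_nat_0_le_iff)
  then have "1 < card J" by simp
  then obtain m1 m2 where m: "m1 \<in> J" "m2 \<in> J" "m1 < m2"
    by (metis One_nat_def card_le_Suc0_iff_eq J linorder_neqE_nat not_less)
  have "marker k (Suc m1) \<le> marker k m2" using m(3) marker_strict_mono[of k] by (simp add: strict_mono_less_eq Suc_le_eq)
  then have S: "L ?S < real (marker k m1) + 1" "real (marker k (Suc m1)) < R ?S" "m1 < 3 * k"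
    using m by (auto simp: J_def)
  show ?thesis
  proof (cases "m1 < 2 * k")
    case True
    obtain i where "m1 = 2 * i \<or> m1 = 2 * i + 1" by (metis oddE evenE)
    then show ?thesis
    proof
      assume m1: "m1 = 2 * i"
      then have i: "i < k" using True by simp
      have "marker k m1 = 9 * i" "marker k (Suc m1) = 9 * i + 2"
        using marker_even[OF i] marker_odd[OF i] m1 by simp_all
      then show ?thesis using that(1)[OF i] S by simp
    next
      assume m1: "m1 = 2 * i + 1"
      then have i: "i < k" using True by simp
      have "marker k m1 = 9 * i + 2" "marker k (Suc m1) = 9 * i + 9"
        using marker_odd_Suc[OF i] marker_odd[OF i] m1 by simp_all
      then show ?thesis using that(2)[OF i] S by simp
    qed
  next
    case False
    define i where "i = m1 - 2 * k"
    have i: "i < k" "m1 = 2 * k + i" using False S(3) by (simp_all add: i_def)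
    have "marker k m1 = 9 * k + 2 * i" "marker k (Suc m1) = 9 * k + 2 * i + 2"
      using marker_late[of k i] marker_late[of k "Suc i"] i by simp_all
    then show ?thesis using that(3)[OF i(1)] S by simp
  qed
qed

text \<open>If player \<open>3k\<close> swallows one of the two outer items of a block, envy forces player \<open>3i\<close> to hold the
  other one entirely; swallowing the middle one is ruled out by player \<open>3i + 1\<close> alone.\<close>

lemma eg_le_inverse: "eg n v X \<le> 1 / real n"
proof (rule ccontr)
  let ?S = "3 * k"
  assume "\<not> ?thesis"
  moreover have "eg n v X \<le> u ?S ?S" by (rule eg_le) simp
  ultimately have big: "1 / real n < u ?S ?S" by simp
  have S: "?S < n" by simp
  show False
    using big
  proof (cases rule: last_player_contains_item)
    case (1 i)
    have lt: "3 * i < n" "3 * i \<noteq> ?S" and ik: "real i + 1 \<le> real k" using 1 by simp_all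
    have cells: "9 * i + 1 < N" "T i < N" using 1(1) by (simp_all add: N_def)
    note V = weight_0_vals[OF 1(1), simplified]
    have "(\<Sum>c\<in>{9 * i + 1}. weight k e (3 * i) c) \<le> u (3 * i) ?S"
      using 1 cells by (intro u_ge) auto
    then have half: "1 / 2 \<le> u (3 * i) (3 * i)" using envy[OF lt(1) S] V by simp
    have "L (3 * i) \<le> real (T i) \<and> real (T i) + 1 \<le> R (3 * i)"
    proof (rule cell_held[OF lt(1) cells(2)])
      fix c assume c: "weight k e (3 * i) c \<noteq> 0" "L (3 * i) < real c + 1" "real c < R (3 * i)"
      show "c = T i"
        using weight_0_supp[OF 1(1) c(1)] c(2,3) disj[OF lt(1) S lt(2)] 1 by auto
    qed (use half V in simp_all)
    then show False using block_obstruction[OF 1(1), of ?S "3 * i"] 1 by blast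
  next
    case (2 i)
    have lt: "3 * i + 1 < n" "3 * i + 1 \<noteq> ?S" and ik: "real i + 1 \<le> real k" using 2 by (simp, presburger, simp)
    have cells: "9 * i + 8 < N" using 2(1) by (simp add: N_def)
    note V = weight_1_vals[OF 2(1), simplified]
    have "(\<Sum>c\<in>{9 * i + 3, 9 * i + 5, 9 * i + 7}. weight k e (3 * i + 1) c) \<le> u (3 * i + 1) ?S"
      using 2 cells by (intro u_ge) auto
    then have ge: "q + e \<le> u (3 * i + 1) (3 * i + 1)" using envy[OF lt(1) S] V by simp
    \<comment> \<open>On either side of the swallowed item player \<open>3 * i + 1\<close> finds
      just one valued cell, worth \<open>q\<close>, against the \<open>q + e\<close> held by player
      \<open>3 * k\<close>.\<close>
    have "\<exists>d\<in>{9 * i + 1, T i}. u (3 * i + 1) (3 * i + 1) \<le> (\<Sum>c\<in>{d}. weight k e (3 * i + 1) c)"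
      using disj[OF lt(1) S lt(2)]
    proof
      assume R: "R (3 * i + 1) \<le> L ?S"
      show ?thesis
      proof (rule bexI[of _ "9 * i + 1"], rule u_le[OF lt(1)])
        fix c assume c: "weight k e (3 * i + 1) c \<noteq> 0" "L (3 * i + 1) < real c + 1" "real c < R (3 * i + 1)"
        show "c \<in> {9 * i + 1}" using weight_1_supp[OF 2(1) c(1)] c(2,3) R 2 ik by auto
      qed simp_all
    next
      assume L: "R ?S \<le> L (3 * i + 1)"
      show ?thesis
      proof (rule bexI[of _ "T i"], rule u_le[OF lt(1)])
        fix c assume c: "weight k e (3 * i + 1) c \<noteq> 0" "L (3 * i + 1) < real c + 1" "real c < R (3 * i + 1)"
        show "c \<in> {T i}" using weight_1_supp[OF 2(1) c(1)] c(2,3) L 2 ik by auto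
      qed simp_all
    qed
    then show False using ge V e by auto
  next
    case (3 i)
    have lt: "3 * i < n" "3 * i \<noteq> ?S" and ik: "real i + 1 \<le> real k" using 3 by simp_all
    have cells: "9 * i + 1 < N" "T i < N" using 3(1) by (simp_all add: N_def)
    note V = weight_0_vals[OF 3(1), simplified]
    have "(\<Sum>c\<in>{T i}. weight k e (3 * i) c) \<le> u (3 * i) ?S"
      using 3 cells by (intro u_ge) auto
    then have half: "1 / 2 \<le> u (3 * i) (3 * i)" using envy[OF lt(1) S] V by simp
    have "L (3 * i) \<le> real (9 * i + 1) \<and> real (9 * i + 1) + 1 \<le> R (3 * i)"
    proof (rule cell_held[OF lt(1) cells(1)])
      fix c assume c: "weight k e (3 * i) c \<noteq> 0" "L (3 * i) < real c + 1" "real c < R (3 * i)"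
      show "c = 9 * i + 1"
        using weight_0_supp[OF 3(1) c(1)] c(2,3) disj[OF lt(1) S lt(2)] 3 by auto
    qed (use half V in simp_all)
    then show False using block_obstruction[OF 3(1), of "3 * i" ?S] 3 by blast
  qed
qed

end

subsection \<open>The partial division\<close>

text \<open>Residues modulo 9 show that the pieces of players \<open>3 * i + 1\<close> (residues 5,
  6, 7) and \<open>3 * i + 2\<close> (residue 8) contain no marker.\<close>

lemma marker_mod_9:
  assumes "marker k m < 9 * k"
  shows "marker k m mod 9 = 0 \<or> marker k m mod 9 = 2"
proof -
  have m: "m < 2 * k" using assms by (auto simp: marker_def split: if_splits)
  obtain i where "m = 2 * i \<or> m = 2 * i + 1" by (metis oddE evenE)
  then show ?thesis
  proof
    assume "m = 2 * i"
    then show ?thesis using m marker_even[of i k] by simp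
  next
    assume "m = 2 * i + 1"
    then have "marker k m = 9 * i + 2" using m marker_odd[of i k] by simp
    then show ?thesis by presburger
  qed
qed

context dumping_instance
begin

text \<open>The piece of player \<open>3 * i\<close> also absorbs the two markers beside its item,
  so that just one gap per block remains. These are worth \<open>2 / n\<close> to player
  \<open>3 * k\<close>, who keeps \<open>k + 1\<close> markers and so does not envy as
  \<open>k\<close> is at least 1.\<close>

definition "lo p = (if p = 3 * k then 9 * k
  else 9 * (p div 3) + (if p mod 3 = 0 then 0 else if p mod 3 = 1 then 5 else 8))"
definition "hi p = (if p = 3 * k then N
  else 9 * (p div 3) + (if p mod 3 = 0 then 3 else if p mod 3 = 1 then 8 else 9))"
definition "Y p = {real (lo p) / N<..<real (hi p) / N}"
definition "gap i = {real (9 * i + 3) / N<..<real (9 * i + 5) / N}"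

lemma lo_hi:
  "lo (3 * k) = 9 * k" "hi (3 * k) = N"
  "i < k \<Longrightarrow> lo (3 * i) = 9 * i" "i < k \<Longrightarrow> hi (3 * i) = 9 * i + 3"
  "i < k \<Longrightarrow> lo (3 * i + 1) = 9 * i + 5" "i < k \<Longrightarrow> hi (3 * i + 1) = 9 * i + 8"
  "i < k \<Longrightarrow> lo (3 * i + 2) = 9 * i + 8" "i < k \<Longrightarrow> hi (3 * i + 2) = 9 * i + 9"
proof -
  show "lo (3 * k) = 9 * k" "hi (3 * k) = N" by (simp_all add: lo_def hi_def)
  assume i: "i < k"
  then have *: "3 * i \<noteq> 3 * k" "3 * i + 1 \<noteq> 3 * k" "3 * i + 2 \<noteq> 3 * k" by presburger+
  have d: "(3 * i + 1) div 3 = i" "(3 * i + 1) mod 3 = 1" "(3 * i + 2) div 3 = i" "(3 * i + 2) mod 3 = 2"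
    by presburger+
  show "lo (3 * i) = 9 * i" "hi (3 * i) = 9 * i + 3" using * by (simp_all add: lo_def hi_def)
  show "lo (3 * i + 1) = 9 * i + 5" "hi (3 * i + 1) = 9 * i + 8"
    unfolding lo_def hi_def d using * by (simp_all only: if_False) simp_all
  show "lo (3 * i + 2) = 9 * i + 8" "hi (3 * i + 2) = 9 * i + 9"
    unfolding lo_def hi_def d using * by (simp_all only: if_False) simp_all
qed

lemma lo_hi_bounds:
  assumes "p < n"
  shows "lo p < hi p" "hi p \<le> N"
  using assms by (cases rule: player_cases; simp only: lo_hi; simp add: N_def)+

lemma hi_le_lo:
  assumes p: "p < p'" and p': "p' < n"
  shows "hi p \<le> lo p'"
proof -
  define d r d' r' where dr: "d = p div 3" "r = p mod 3" "d' = p' div 3" "r' = p' mod 3"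
  have pd: "p = 3 * d + r" "r < 3" "p' = 3 * d' + r'" "r' < 3" by (simp_all add: dr)
  have p_k: "p < 3 * k" using assms by simp
  then have d_k: "d < k" using pd by simp
  have hi_le: "hi p \<le> 9 * d + 9" using p_k by (simp add: hi_def dr)
  consider "p' = 3 * k" | "p' < 3 * k" "d < d'" | "p' < 3 * k" "d = d'" "r < r'"
    using p p' pd by linarith
  then show ?thesis
  proof cases
    case 1
    then show ?thesis using hi_le d_k by (simp add: lo_def)
  next
    case 2
    then have "9 * d' \<le> lo p'" by (simp add: lo_def dr)
    then show ?thesis using hi_le 2 by simp
  next
    case 3
    then have "r = 0 \<or> r = 1 \<and> r' = 2" using pd by linarith
    then show ?thesis using 3 p_k unfolding hi_def lo_def dr[symmetric] by auto
  qed
qed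

lemma Y_division: "division n Y"
  unfolding division_def
proof (intro conjI allI impI)
  show "\<exists>a b. 0 \<le> a \<and> a \<le> b \<and> b \<le> 1 \<and> Y i = {a<..<b}" if "i < n" for i
    using lo_hi_bounds[OF that] N_pos unfolding Y_def
    by (intro exI[of _ "real (lo i) / N"] exI[of _ "real (hi i) / N"]) (simp add: divide_right_mono)
  have "Y i \<inter> Y j = {}" if "i < j" "j < n" for i j
  proof -
    have "real (hi i) / N \<le> real (lo j) / N" using hi_le_lo[OF that] by (simp add: divide_right_mono)
    then show ?thesis by (auto simp: Y_def)
  qed
  then show "Y i \<inter> Y j = {}" if "i < n" "j < n" "i \<noteq> j" for i j
    using that by (metis Int_commute linorder_neqE_nat)
qed

lemma util_Y:
  assumes "j < n"
  shows "util v Y p j = (\<Sum>c\<in>{lo j..<hi j}. weight k e p c)"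
  unfolding util_def v_def Y_def using lo_hi_bounds[OF assms]
  by (intro measure_step_measure_cells[OF N_pos weight_nonneg]) simp_all

lemma util_Y_own:
  assumes "i < k"
  shows "util v Y (3 * i) (3 * i) = 1 / 2" "util v Y (3 * i + 1) (3 * i + 1) = q"
    "util v Y (3 * i + 2) (3 * i + 2) = q"
proof -
  have n: "3 * i < n" "3 * i + 1 < n" "3 * i + 2 < n" using assms by simp_all
  show "util v Y (3 * i) (3 * i) = 1 / 2"
    unfolding util_Y[OF n(1)] lo_hi(3,4)[OF assms] weight_0[OF assms] using assms
    by (simp add: sum.distrib sum_spike)
  show "util v Y (3 * i + 1) (3 * i + 1) = q"
    unfolding util_Y[OF n(2)] lo_hi(5,6)[OF assms] weight_1[OF assms] using assms
    by (simp add: sum.distrib sum_spike)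
  show "util v Y (3 * i + 2) (3 * i + 2) = q"
    unfolding util_Y[OF n(3)] lo_hi(7,8)[OF assms] weight_2[OF assms] using assms
    by (simp add: sum.distrib sum_spike)
qed

lemma util_Y_0_le:
  assumes i: "i < k" and j: "j < n"
  shows "util v Y (3 * i) j \<le> 1 / 2"
proof -
  have "\<not> (9 * i + 1 \<in> {lo j..<hi j} \<and> T i \<in> {lo j..<hi j})"
    using j by (cases rule: player_cases) (use i in \<open>auto simp: lo_hi lo_hi[simplified] N_def\<close>)
  then show ?thesis unfolding util_Y[OF j] weight_0[OF i] sum.distrib by (simp add: sum_spike)
qed

lemma util_Y_1_le:
  assumes i: "i < k" and j: "j < n"
  shows "util v Y (3 * i + 1) j \<le> q"
proof -
  have eq: "util v Y (3 * i + 1) j = (if 9 * i + 1 \<in> {lo j..<hi j} then q else 0)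
      + (if 9 * i + 3 \<in> {lo j..<hi j} then e else 0) + (if 9 * i + 5 \<in> {lo j..<hi j} then q / 2 else 0)
      + (if 9 * i + 7 \<in> {lo j..<hi j} then q / 2 else 0) + (if T i \<in> {lo j..<hi j} then q else 0)"
    unfolding util_Y[OF j] weight_1[OF i] sum.distrib by (simp only: sum_spike finite_atLeastLessThan)
  show ?thesis
    using j
  proof (cases rule: player_cases)
    case 1
    then show ?thesis unfolding eq unfolding 1 lo_hi using i q by auto
  next
    case (2 l)
    show ?thesis unfolding eq unfolding 2 lo_hi(3,4)[OF 2(1)]
      by (cases i l rule: linorder_cases) (use i 2(1) q in auto)
  next
    case (3 l)
    show ?thesis unfolding eq unfolding 3 lo_hi(5,6)[OF 3(1)]
      by (cases i l rule: linorder_cases) (use i 3(1) q in auto)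
  next
    case (4 l)
    show ?thesis unfolding eq unfolding 4 lo_hi(7,8)[OF 4(1)]
      by (cases i l rule: linorder_cases) (use i 4(1) q in auto)
  qed
qed

lemma util_Y_2_le:
  assumes i: "i < k" and j: "j < n"
  shows "util v Y (3 * i + 2) j \<le> q"
proof -
  have eq: "util v Y (3 * i + 2) j = (if 9 * i + 4 \<in> {lo j..<hi j} then e else 0)
      + (if 9 * i + 6 \<in> {lo j..<hi j} then q else 0) + (if 9 * i + 8 \<in> {lo j..<hi j} then q else 0)
      + (if T i \<in> {lo j..<hi j} then q else 0)"
    unfolding util_Y[OF j] weight_2[OF i] sum.distrib by (simp only: sum_spike finite_atLeastLessThan)
  show ?thesis
    using j
  proof (cases rule: player_cases)
    case 1
    then show ?thesis unfolding eq unfolding 1 lo_hi using i q by auto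
  next
    case (2 l)
    show ?thesis unfolding eq unfolding 2 lo_hi(3,4)[OF 2(1)]
      by (cases i l rule: linorder_cases) (use i 2(1) q in auto)
  next
    case (3 l)
    show ?thesis unfolding eq unfolding 3 lo_hi(5,6)[OF 3(1)]
      by (cases i l rule: linorder_cases) (use i 3(1) q in auto)
  next
    case (4 l)
    show ?thesis unfolding eq unfolding 4 lo_hi(7,8)[OF 4(1)]
      by (cases i l rule: linorder_cases) (use i 4(1) q in auto)
  qed
qed

lemma weight_last_zero:
  assumes "c < 9 * k" "c mod 9 \<noteq> 0" "c mod 9 \<noteq> 2"
  shows "weight k e (3 * k) c = 0"
proof -
  have "c \<notin> marker k ` {..3 * k}"
  proof
    assume "c \<in> marker k ` {..3 * k}"
    then obtain m where "c = marker k m" by blast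
    then show False using marker_mod_9[of k m] assms by simp
  qed
  then show ?thesis unfolding weight_last by (rule if_not_P)
qed

lemma weight_last_le: "weight k e (3 * k) c \<le> 1 / real n"
  by (simp add: weight_last)

lemma util_Y_last_own: "real (k + 1) / real n \<le> util v Y (3 * k) (3 * k)"
proof -
  have inj: "inj (marker k)" using marker_strict_mono by (rule strict_mono_imp_inj_on)
  have sub: "marker k ` {2 * k..3 * k} \<subseteq> {9 * k..<N}" by (auto simp: marker_def N_def)
  have "real (k + 1) / real n = (\<Sum>c\<in>marker k ` {2 * k..3 * k}. 1 / real n)"
    using card_image[OF inj_on_subset[OF inj], of "{2 * k..3 * k}"] by simp
  also have "\<dots> = (\<Sum>c\<in>marker k ` {2 * k..3 * k}. weight k e (3 * k) c)"
    by (intro sum.cong) (auto simp: weight_last)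
  also have "\<dots> \<le> (\<Sum>c\<in>{9 * k..<N}. weight k e (3 * k) c)"
    using sub weight_nonneg by (intro sum_mono2) auto
  finally show ?thesis by (subst util_Y) (simp_all add: lo_hi)
qed

lemma util_Y_last_le:
  assumes j: "j < 3 * k"
  shows "util v Y (3 * k) j \<le> 2 / real n"
proof -
  let ?w = "weight k e (3 * k)"
  have jn: "j < n" using j by simp
  have mod_9: "(9 * i + l) mod 9 = l" if "l < 9" for i l :: nat using that by simp
  have "(\<Sum>c\<in>{lo j..<hi j}. ?w c) \<le> 2 / real n"
    using jn
  proof (cases rule: player_cases)
    case 1
    then show ?thesis using j by simp
  next
    case (2 i)
    have "{9 * i..<9 * i + 3} = {9 * i, 9 * i + 1, 9 * i + 2}" by auto
    then have "(\<Sum>c\<in>{lo j..<hi j}. ?w c) = ?w (9 * i) + ?w (9 * i + 1) + ?w (9 * i + 2)"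
      unfolding 2 lo_hi(3,4)[OF 2(1)] by simp
    moreover have "?w (9 * i + 1) = 0" using 2(1) mod_9[of 1 i] by (intro weight_last_zero) simp_all
    ultimately show ?thesis using weight_last_le[of "9 * i"] weight_last_le[of "9 * i + 2"] by simp
  next
    case (3 i)
    have "?w c = 0" if "c \<in> {9 * i + 5..<9 * i + 8}" for c
    proof (rule weight_last_zero)
      have "c = 9 * i + 5 \<or> c = 9 * i + 6 \<or> c = 9 * i + 7" using that by auto
      then have "c mod 9 = 5 \<or> c mod 9 = 6 \<or> c mod 9 = 7" using mod_9 by auto
      then show "c mod 9 \<noteq> 0" "c mod 9 \<noteq> 2" by auto
      show "c < 9 * k" using that 3(1) by simp
    qed
    then show ?thesis unfolding 3 lo_hi(5,6)[OF 3(1)] by simp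
  next
    case (4 i)
    have "?w c = 0" if "c \<in> {9 * i + 8..<9 * i + 9}" for c
    proof (rule weight_last_zero)
      have "c = 9 * i + 8" using that by auto
      then have "c mod 9 = 8" using mod_9 by simp
      then show "c mod 9 \<noteq> 0" "c mod 9 \<noteq> 2" by auto
      show "c < 9 * k" using that 4(1) by simp
    qed
    then show ?thesis unfolding 4 lo_hi(7,8)[OF 4(1)] by simp
  qed
  then show ?thesis by (simp only: util_Y[OF jn])
qed

lemma Y_envy_free: "envy_free n v Y"
  unfolding envy_free_def
proof (intro allI impI)
  fix p j assume p: "p < n" and j: "j < n"
  show "util v Y p j \<le> util v Y p p"
    using p
  proof (cases rule: player_cases)
    case 1
    show ?thesis
    proof (cases "j = 3 * k")
      case False
      then have "util v Y (3 * k) j \<le> 2 / real n" using j by (intro util_Y_last_le) simp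
      also have "\<dots> \<le> real (k + 1) / real n" using k by (intro divide_right_mono) simp_all
      finally show ?thesis using util_Y_last_own 1 by simp
    qed (simp add: 1)
  next
    case (2 i)
    show ?thesis unfolding 2(2) util_Y_own[OF 2(1)] by (rule util_Y_0_le[OF 2(1) j])
  next
    case (3 i)
    show ?thesis unfolding 3(2) util_Y_own[OF 3(1)] by (rule util_Y_1_le[OF 3(1) j])
  next
    case (4 i)
    show ?thesis unfolding 4(2) util_Y_own[OF 4(1)] by (rule util_Y_2_le[OF 4(1) j])
  qed
qed

lemma eg_Y: "eg n v Y = q"
proof (rule antisym)
  have "eg n v Y \<le> util v Y (3 * 0 + 1) (3 * 0 + 1)" using k by (intro eg_le) simp
  then show "eg n v Y \<le> q" using util_Y_own(2)[of 0] k by simp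
  show "q \<le> eg n v Y"
  proof (rule le_eg)
    fix p assume "p < n"
    then show "q \<le> util v Y p p"
    proof (cases rule: player_cases)
      case 1
      have "q \<le> 1 / 3" using q by simp
      \<comment> \<open>This is where the late markers must make up at least a third of all
        \<open>3 * k + 1\<close>.\<close>
      also have "\<dots> \<le> real (k + 1) / real n" by (simp add: field_simps)
      finally show ?thesis using util_Y_last_own 1 by simp
    next
      case (2 i)
      show ?thesis unfolding 2(2) util_Y_own[OF 2(1)] using q by simp
    next
      case (3 i)
      show ?thesis unfolding 3(2) util_Y_own[OF 3(1)] by simp
    next
      case (4 i)
      show ?thesis unfolding 4(2) util_Y_own[OF 4(1)] by simp
    qed
  qed simp
qed

lemma mem_closure_Y:
  assumes "j < n"
  shows "x \<in> closure (Y j) \<longleftrightarrow> real (lo j) \<le> real N * x \<and> real N * x \<le> real (hi j)"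
proof -
  have "real (lo j) / N < real (hi j) / N"
    using lo_hi_bounds[OF assms] N_pos by (simp add: divide_strict_right_mono)
  then have "closure (Y j) = {real (lo j) / N..real (hi j) / N}" by (simp add: Y_def)
  then show ?thesis using N_pos by (simp add: field_simps)
qed

lemma mem_gap: "x \<in> gap i \<longleftrightarrow> 9 * real i + 3 < real N * x \<and> real N * x < 9 * real i + 5"
  using N_pos by (simp add: gap_def field_simps)

text \<open>In block \<open>i\<close> the closed pieces cover everything except the open stretch
  between \<open>9 * i + 3\<close> and \<open>9 * i + 5\<close>, and from \<open>9 * k\<close> on
  the last piece covers the rest.\<close>

lemma unallocated_eq: "{0..1} - (\<Union>j<n. closure (Y j)) = (\<Union>i<k. gap i)"
proof (intro equalityI subsetI)
  fix x assume x: "x \<in> {0..1} - (\<Union>j<n. closure (Y j))"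
  define t where "t = real N * x"
  have t: "0 \<le> t" "t \<le> real N" using x N_pos by (simp_all add: t_def mult_left_le)
  have out: "\<not> (real (lo j) \<le> t \<and> t \<le> real (hi j))" if "j < n" for j
    using x that mem_closure_Y[OF that, of x] by (auto simp: t_def)
  have "t < 9 * real k" using out[of "3 * k"] t by (simp add: lo_hi)
  \<comment> \<open>The block containing the point.\<close>
  define i where "i = nat \<lfloor>t / 9\<rfloor>"
  have i: "9 * real i \<le> t" "t < 9 * real i + 9" using t(1) by (simp_all add: i_def) linarith+
  then have ik: "i < k" using \<open>t < 9 * real k\<close> by linarith
  have "3 * i < n" "3 * i + 1 < n" "3 * i + 2 < n" using ik by simp_all
  note o = this[THEN out, unfolded lo_hi(3-8)[OF ik]]
  have "x \<in> gap i" unfolding mem_gap t_def[symmetric] using o i by auto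
  then show "x \<in> (\<Union>i<k. gap i)" using ik by blast
next
  fix x assume "x \<in> (\<Union>i<k. gap i)"
  then obtain i where i: "i < k" and "x \<in> gap i" by blast
  then have x: "9 * real i + 3 < real N * x" "real N * x < 9 * real i + 5" by (simp_all add: mem_gap)
  have ik: "real i + 1 \<le> real k" using i by simp
  have "0 < real N * x" using x by linarith
  then have "0 < x" using N_pos by (simp add: zero_less_mult_iff)
  moreover have "9 * real i + 5 \<le> real N" using ik by (simp add: N_def)
  then have "real N * x < real N * 1" using x by linarith
  then have "x < 1" using N_pos by (simp only: mult_less_cancel_left_pos of_nat_0_less_iff)
  moreover have "x \<notin> closure (Y j)" if j: "j < n" for j
  proof -
    have "hi j \<le> 9 * i + 3 \<or> 9 * i + 5 \<le> lo j"
      using j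
    proof (cases rule: player_cases)
      case 1
      then show ?thesis using i by (simp add: lo_hi)
    next
      case (2 l)
      show ?thesis unfolding 2(2) lo_hi(3,4)[OF 2(1)] by (cases i l rule: linorder_cases) auto
    next
      case (3 l)
      show ?thesis unfolding 3(2) lo_hi(5,6)[OF 3(1)] by (cases i l rule: linorder_cases) auto
    next
      case (4 l)
      show ?thesis unfolding 4(2) lo_hi(7,8)[OF 4(1)] by (cases i l rule: linorder_cases) auto
    qed
    then have "real (hi j) \<le> 9 * real i + 3 \<or> 9 * real i + 5 \<le> real (lo j)" by linarith
    then show ?thesis unfolding mem_closure_Y[OF j] using x by linarith
  qed
  ultimately show "x \<in> {0..1} - (\<Union>j<n. closure (Y j))" by auto
qed

lemma card_components_unallocated: "card (components ({0..1} - (\<Union>j<n. closure (Y j)))) = k"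
proof -
  have ne: "gap i \<noteq> {}" for i
  proof -
    have "(9 * real i + 4) / N \<in> gap i" using N_pos by (simp add: mem_gap)
    then show ?thesis by blast
  qed
  have disj: "gap i \<inter> gap j = {}" if "i \<noteq> j" for i j
  proof -
    have "real i + 1 \<le> real j \<or> real j + 1 \<le> real i" using that by linarith
    then have "\<not> (x \<in> gap i \<and> x \<in> gap j)" for x unfolding mem_gap by linarith
    then show ?thesis by blast
  qed
  have "components (\<Union>i<k. gap i) = gap ` {..<k}"
  proof (rule components_open_unique)
    show "pairwise disjnt (gap ` {..<k})"
    proof (rule pairwiseI)
      fix A B assume "A \<in> gap ` {..<k}" "B \<in> gap ` {..<k}" "A \<noteq> B"
      then obtain i j where "A = gap i" "B = gap j" "i \<noteq> j" by blast
      then show "disjnt A B" using disj[of i j] by (simp add: disjnt_def)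
    qed
    show "open X \<and> connected X \<and> X \<noteq> {}" if "X \<in> gap ` {..<k}" for X
      using that ne by (auto simp: gap_def)
  qed simp
  moreover have "inj_on gap {..<k}"
  proof (rule inj_onI, rule ccontr)
    fix i j assume "gap i = gap j" "i \<noteq> j"
    then show False using disj[of i j] ne[of i] by simp
  qed
  ultimately show ?thesis unfolding unallocated_eq by (simp add: card_image)
qed

lemma Y_not_complete: "\<not> complete_div n Y"
  using card_components_unallocated k by (auto simp: complete_div_def)

lemma complete_envy_free_eg_le:
  assumes X: "division n X" "complete_div n X" "envy_free n v X"
  shows "eg n v X \<le> 1 / real n"
proof -
  obtain a b where "\<And>i. i < n \<Longrightarrow> 0 \<le> a i \<and> a i \<le> b i \<and> b i \<le> 1 \<and> X i = {a i<..<b i}"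
    by (rule divisionE[OF X(1)], rule that)
  then interpret complete_ef k e X a b using X by unfold_locales
  show ?thesis by (rule eg_le_inverse)
qed

text \<open>The factor is the welfare \<open>q\<close> of the partial division divided by the bound
  \<open>1 / n\<close> for complete ones.\<close>

lemma eg_dumping_paradox_v:
  assumes "1 < (1 - e) * real n / 3"
  shows "eg_dumping_paradox n v ((1 - e) * real n / 3)"
  unfolding eg_dumping_paradox_def
proof (intro conjI exI[of _ Y] allI impI)
  fix X assume "division n X \<and> complete_div n X \<and> envy_free n v X"
  then have "eg n v X \<le> 1 / real n" using complete_envy_free_eg_le by blast
  then have "(1 - e) * real n / 3 * eg n v X \<le> (1 - e) * real n / 3 * (1 / real n)"
    using assms by (intro mult_left_mono) simp_all
  also have "\<dots> = q"
  proof -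
    have *: "(1 - e) * x / 3 * (1 / x) = q" if "x \<noteq> 0" for x :: real using that by (simp add: q_def)
    show ?thesis by (rule *[of "real n"]) simp
  qed
  finally show "(1 - e) * real n / 3 * eg n v X \<le> eg n v Y" by (simp only: eg_Y)
qed (use assms Y_division Y_not_complete Y_envy_free in simp_all)

end

theorem theorem2:
  shows "(\<forall>k::nat. k \<ge> 1 \<longrightarrow>
            (\<forall>\<delta>::real. \<delta> > 0 \<longrightarrow>
               (\<exists>v \<alpha>. cake_instance (3*k+1) v \<and> eg_dumping_paradox (3*k+1) v \<alpha>
                      \<and> \<alpha> \<ge> (1 - \<delta>) * real (3*k+1) / 3))
          \<and> (\<exists>\<epsilon>\<^sub>0>0. \<forall>\<epsilon>::real. 0 < \<epsilon> \<and> \<epsilon> < \<epsilon>\<^sub>0 \<longrightarrow>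
               (\<exists>v. cake_instance (3*k+1) v
                  \<and> (\<forall>X. division (3*k+1) X \<and> complete_div (3*k+1) X \<and> envy_free (3*k+1) v X
                         \<longrightarrow> eg (3*k+1) v X \<le> 1 / real (3*k+1))
                  \<and> (\<exists>Y. division (3*k+1) Y \<and> \<not> complete_div (3*k+1) Y \<and> envy_free (3*k+1) v Y
                         \<and> card (components ({0..1} - (\<Union>i<3*k+1. closure (Y i)))) = k
                         \<and> eg (3*k+1) v Y = (1 - \<epsilon>) / 3))))
        \<and> (\<forall>n::nat. \<forall>v \<alpha>. n \<ge> 1 \<and> cake_instance n v \<and> eg_dumping_paradox n v \<alpha>
              \<longrightarrow> \<alpha> \<le> real n / 2)"
proof (intro conjI allI impI)
  fix k :: nat and \<delta> :: real assume k: "1 \<le> k" and \<delta>: "0 < \<delta>"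
  \<comment> \<open>The cap 1/8 lies below the 1/7 of the locale and also makes the factor exceed 1:
    \<open>n\<close> is at least 4, and 7/8 times 4 is 3.5, more than 3.\<close>
  define c where "c = min \<delta> (1 / 8)"
  have c: "0 < c" "c < 1 / 7" "c \<le> \<delta>" "c \<le> 1 / 8" using \<delta> by (auto simp: c_def)
  interpret dumping_instance k c using k c by unfold_locales
  have "7 / 8 * 4 \<le> (1 - c) * real (3 * k + 1)" using k c(4) by (intro mult_mono) simp_all
  then have "eg_dumping_paradox (3 * k + 1) v ((1 - c) * real (3 * k + 1) / 3)"
    by (intro eg_dumping_paradox_v) simp
  moreover have "(1 - \<delta>) * real (3 * k + 1) / 3 \<le> (1 - c) * real (3 * k + 1) / 3"
    using c(3) by (intro divide_right_mono mult_right_mono) simp_all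
  ultimately show "\<exists>v \<alpha>. cake_instance (3*k+1) v \<and> eg_dumping_paradox (3*k+1) v \<alpha>
      \<and> \<alpha> \<ge> (1 - \<delta>) * real (3*k+1) / 3"
    using cake_instance_v by blast
next
  fix k :: nat assume k: "1 \<le> k"
  have "\<exists>v. cake_instance (3*k+1) v
      \<and> (\<forall>X. division (3*k+1) X \<and> complete_div (3*k+1) X \<and> envy_free (3*k+1) v X
             \<longrightarrow> eg (3*k+1) v X \<le> 1 / real (3*k+1))
      \<and> (\<exists>Y. division (3*k+1) Y \<and> \<not> complete_div (3*k+1) Y \<and> envy_free (3*k+1) v Y
             \<and> card (components ({0..1} - (\<Union>i<3*k+1. closure (Y i)))) = k
             \<and> eg (3*k+1) v Y = (1 - e) / 3)" if "0 < e" "e < 1 / 7" for e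
  proof -
    interpret dumping_instance k e using k that by unfold_locales
    show ?thesis
      using cake_instance_v complete_envy_free_eg_le Y_division Y_not_complete Y_envy_free
        card_components_unallocated eg_Y[unfolded q_def] by blast
  qed
  then show "\<exists>\<epsilon>\<^sub>0>0. \<forall>\<epsilon>::real. 0 < \<epsilon> \<and> \<epsilon> < \<epsilon>\<^sub>0 \<longrightarrow>
      (\<exists>v. cake_instance (3*k+1) v
         \<and> (\<forall>X. division (3*k+1) X \<and> complete_div (3*k+1) X \<and> envy_free (3*k+1) v X
                \<longrightarrow> eg (3*k+1) v X \<le> 1 / real (3*k+1))
         \<and> (\<exists>Y. division (3*k+1) Y \<and> \<not> complete_div (3*k+1) Y \<and> envy_free (3*k+1) v Y
                \<and> card (components ({0..1} - (\<Union>i<3*k+1. closure (Y i)))) = k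
                \<and> eg (3*k+1) v Y = (1 - \<epsilon>) / 3))"
    by (intro exI[of _ "1 / 7"]) simp
next
  fix n :: nat and v :: "nat \<Rightarrow> real measure" and \<alpha> :: real
  assume "n \<ge> 1 \<and> cake_instance n v \<and> eg_dumping_paradox n v \<alpha>"
  then show "\<alpha> \<le> real n / 2" using eg_dumping_paradox_upper_bound by blast
qed

end
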